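(* Let $\mathbf r,\mathbf a\in\mathbb R^3$ with $|\mathbf a|>|\mathbf r|>0$, and put $\mathbf r'=\mathbf r+\mathbf a$, $r=|\mathbf r|$, $r'=|\mathbf r'|$. Then for all integers $l\ge0$ and $|m|\le l$ the real vector spherical harmonic $X_{lm}$ satisfies $$r'^{-l-1}X_{lm}(\hat{\mathbf r}')=\sum_{\lambda=1}^\infty\sum_{\mu=-\lambda}^\lambda r^\lambda H_{l,\lambda}^{[m],\mu}(\mathbf a)X_\lambda^\mu(\hat{\mathbf r})+\sum_{\lambda=1}^\infty\sum_{\mu=-\lambda}^\lambda\sum_{q=-1}^1\sum_{m_1=-1}^1\ \sum_{|\lambda-2|\le j\le\lambda}r^{\lambda-1}L_{l,j,\lambda}^{[m],\mu,q,m_1}(\mathbf a)\,\vec Y_{j,\lambda-1,q+\mu}(\hat{\mathbf r}),$$ where $X_\lambda^\mu$ and $\vec Y_{j,\lambda-1,\nu}$ are expressed through the real vector spherical harmonics by: for each $Z\in\{V,W,X\}$, $$Z_\lambda^\mu=\begin{cases}\frac{(-1)^\mu}{\sqrt2}(Z_{\lambda\mu}+iZ_{\lambda,-\mu}),&\mu>0,\\ Z_{\lambda0},&\mu=0,\\ \frac1{\sqrt2}(Z_{\lambda,-\mu}-iZ_{\lambda\mu}),&\mu<0,\end{cases}$$ $$\vec Y_{\lambda-2,\lambda-1,\nu}=\frac{V_{\lambda-2}^\nu}{\sqrt{(\lambda-1)(2\lambda-3)}},\qquad\vec Y_{\lambda-1,\lambda-1,\nu}=\frac{-i\,X_{\lambda-1}^\nu}{\sqrt{(\lambda-1)\lambda}},\qquad\vec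 Y_{\lambda,\lambda-1,\nu}=\frac{W_\lambda^\nu}{\sqrt{\lambda(2\lambda+1)}}.$$
   Context: For nonzero $\mathbf r$, $\hat{\mathbf r}=\mathbf r/|\mathbf r|$. $Y_l^m$ are the standard $L^2$-orthonormal complex spherical harmonics on the unit sphere with Condon–Shortley phase. Real spherical harmonics: $Y_{lm}=\frac1{\sqrt2}(Y_l^{-m}+(-1)^mY_l^m)$ for $m>0$, $Y_{l0}=Y_l^0$, $Y_{lm}=\frac{i}{\sqrt2}(Y_l^m-(-1)^mY_l^{-m})$ for $m<0$. With $\nabla_S$ the surface gradient on the unit sphere: $V_{lm}=\nabla_SY_{lm}-(l+1)Y_{lm}\hat{\mathbf r}$, $W_{lm}=\nabla_SY_{lm}+lY_{lm}\hat{\mathbf r}$, $X_{lm}=\hat{\mathbf r}\times\nabla_SY_{lm}$; $V_l^m,W_l^m,X_l^m$ are given by the same formulas with $Y_l^m$. Irregular solid harmonics: $I_l^m(\mathbf r)=\sqrt{\frac{4\pi}{2l+1}}\,Y_l^m(\hat{\mathbf r})|\mathbf r|^{-l-1}$. For $\lambda\ge1$, $|\mu|\le\lambda$, $$H_{l,\lambda}^{m,\mu}(\mathbf a)=(-1)^{\lambda+\mu}\sqrt{\tfrac{2l+1}{2\lambda+1}}\,I_{l+\lambda}^{m-\mu}(\mathbf a)\sqrt{\tbinom{l+\lambda+\mu-m}{\lambda+\mu}\tbinom{l+\lambda+m-\mu}{\lambda-\mu}}.$$ $\langle j_1,m_1;j_2,m_2\mid j,m\rangle$ are the standard (Condon–Shortley)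 Clebsch–Gordan coefficients, equal to $0$ for inadmissible indices. For $\mathbf a=(a_x,a_y,a_z)$, $a_{-q}=\frac1{\sqrt2}(a_x-ia_y)$ if $q=1$, $a_z$ if $q=0$, $-\frac1{\sqrt2}(a_x+ia_y)$ if $q=-1$. Put $$L_{l,j,\lambda}^{m,\mu,q,m_1}(\mathbf a)=i(-1)^{\lambda+\mu+q}\,\mathrm{sgn}(q-m_1)\,a_{-q}\sqrt{\lambda(2l+1)}\,I_{l+\lambda}^{m-\mu}(\mathbf a)\sqrt{\tbinom{l+\lambda+\mu-m}{\lambda+\mu}\tbinom{l+\lambda+m-\mu}{\lambda-\mu}}\,\langle\lambda-1,\mu-m_1;1,m_1\mid\lambda,\mu\rangle\langle\lambda-1,\mu-m_1;1,q+m_1\mid j,\mu+q\rangle,$$ with $\mathrm{sgn}(0)=0$. For a family $F^{m}$ ($F=H_{l,\lambda}^{\cdot,\mu}$ or $F=L_{l,j,\lambda}^{\cdot,\mu,q,m_1}$) write $F^{[m]}=\frac1{\sqrt2}(F^{-m}+(-1)^mF^m)$ for $m>0$, $F^{[0]}=F^0$, $F^{[m]}=\frac{i}{\sqrt2}(F^m-(-1)^mF^{-m})$ for $m<0$. Terms with $|q+\mu|>j$ have vanishing coefficient and are understood to be zero. Infinite sums over $\lambda$ are limits of partial sums (inner sums are finite). *)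

theory Defs
  imports "HOL-Analysis.Analysis" "HOL-Computational_Algebra.Polynomial"
begin

section \<open>Spherical harmonics\<close>

text \<open>Rodrigues' formula.\<close>

definition legendre_poly :: "nat \<Rightarrow> real poly" where
  "legendre_poly l = smult (1 / (2 ^ l * fact l)) ((pderiv ^^ l) ([:-1, 0, 1:] ^ l))"

text \<open>Associated Legendre functions of order \<open>m \<ge> 0\<close>, with the Condon--Shortley phase;
  \<open>sqrt (1 - x\<^sup>2) ^ m\<close> is \<open>(1 - x\<^sup>2)\<close> to the power \<open>m/2\<close>.\<close>

definition assoc_legendre :: "nat \<Rightarrow> nat \<Rightarrow> real \<Rightarrow> real" where
  "assoc_legendre l m x = (-1) ^ m * sqrt (1 - x\<^sup>2) ^ m * poly ((pderiv ^^ m) (legendre_poly l)) x"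

text \<open>\<open>sph_harm l m u\<close> is the complex spherical harmonic of degree \<open>l\<close> and order \<open>m\<close>, for a unit
  vector \<open>u\<close> with polar angle \<open>arccos (u$3)\<close> and azimuth \<open>Arg (u$1 + i u$2)\<close>. At the poles the
  azimuth is irrelevant, since \<open>assoc_legendre l m\<close> vanishes there for \<open>m > 0\<close>. The value is \<open>0\<close>
  for \<open>\<bar>m\<bar> > l\<close>.\<close>

definition sph_harm_nonneg :: "nat \<Rightarrow> nat \<Rightarrow> real^3 \<Rightarrow> complex" where
  "sph_harm_nonneg l m u =
     of_real (sqrt ((2 * real l + 1) / (4 * pi) * (fact (l - m) / fact (l + m)))
              * assoc_legendre l m (u$3))
     * cis (real m * Arg (Complex (u$1) (u$2)))"

definition sph_harm :: "nat \<Rightarrow> int \<Rightarrow> real^3 \<Rightarrow> complex" where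
  "sph_harm l m u =
     (if m \<ge> 0 then sph_harm_nonneg l (nat m) u
      else (-1) powi m * cnj (sph_harm_nonneg l (nat (-m)) u))"

text \<open>The passage from a family \<open>F\<close> indexed by complex orders to real orders. It gives both the
  real spherical harmonics and the bracketed families \<open>F\<^bsup>[m]\<^esup>\<close>.\<close>

definition real_order :: "(int \<Rightarrow> complex) \<Rightarrow> int \<Rightarrow> complex" where
  "real_order F m =
     (if m > 0 then 1 / of_real (sqrt 2) * (F (-m) + (-1) powi m * F m)
      else if m = 0 then F 0
      else \<i> / of_real (sqrt 2) * (F m - (-1) powi m * F (-m)))"

text \<open>Real-valued, but typed as complex so that the formulas below apply to both families.\<close>

definition real_sph_harm :: "nat \<Rightarrow> int \<Rightarrow> real^3 \<Rightarrow> complex" where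
  "real_sph_harm l m u = real_order (\<lambda>k. sph_harm l k u) m"


section \<open>Vector spherical harmonics\<close>

definition cvec :: "real^3 \<Rightarrow> complex^3" where
  "cvec u = (\<chi> i. complex_of_real (u$i))"

definition ccross :: "complex^3 \<Rightarrow> complex^3 \<Rightarrow> complex^3" where
  "ccross v w = vector [v$2 * w$3 - v$3 * w$2, v$3 * w$1 - v$1 * w$3, v$1 * w$2 - v$2 * w$1]"

text \<open>Surface gradient at a unit vector \<open>u\<close> of a function \<open>f\<close> on the unit sphere: the ordinary
  gradient at \<open>u\<close> of the extension \<open>x \<mapsto> f (x / \<bar>x\<bar>)\<close>, which is constant along rays.\<close>

definition surf_grad :: "(real^3 \<Rightarrow> complex) \<Rightarrow> real^3 \<Rightarrow> complex^3" where
  "surf_grad f u = (\<chi> i. frechet_derivative (\<lambda>x. f (sgn x)) (at u) (axis i 1))"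

text \<open>Vector harmonics built from a scalar harmonic \<open>f\<close> of degree \<open>l\<close>: with
  \<open>f = real_sph_harm l m\<close> these are \<open>V\<^bsub>lm\<^esub>, W\<^bsub>lm\<^esub>, X\<^bsub>lm\<^esub>\<close>, and with \<open>f = sph_harm l m\<close> their complex
  counterparts. The degree is not used in \<open>vsh_X\<close>; it is kept so that all three have one type.\<close>

definition vsh_V :: "nat \<Rightarrow> (real^3 \<Rightarrow> complex) \<Rightarrow> real^3 \<Rightarrow> complex^3" where
  "vsh_V l f u = surf_grad f u - ((of_nat l + 1) * f u) *s cvec u"

definition vsh_W :: "nat \<Rightarrow> (real^3 \<Rightarrow> complex) \<Rightarrow> real^3 \<Rightarrow> complex^3" where
  "vsh_W l f u = surf_grad f u + (of_nat l * f u) *s cvec u"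

definition vsh_X :: "nat \<Rightarrow> (real^3 \<Rightarrow> complex) \<Rightarrow> real^3 \<Rightarrow> complex^3" where
  "vsh_X l f u = ccross (cvec u) (surf_grad f u)"

text \<open>\<open>vec_Y j k \<nu>\<close> with \<open>k = \<lambda> - 1\<close> and \<open>j \<in> {\<lambda> - 2, \<lambda> - 1, \<lambda>}\<close>; no other \<open>j\<close> is ever used.\<close>

definition vec_Y :: "nat \<Rightarrow> nat \<Rightarrow> int \<Rightarrow> real^3 \<Rightarrow> complex^3" where
  "vec_Y j k \<nu> u =
     (let la = real k + 1 in
      if j = k + 1 then (1 / of_real (sqrt (la * (2 * la + 1)))) *s vsh_W j (sph_harm j \<nu>) u
      else if j = k then (- \<i> / of_real (sqrt ((la - 1) * la))) *s vsh_X j (sph_harm j \<nu>) u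
      else if j + 1 = k then (1 / of_real (sqrt ((la - 1) * (2 * la - 3)))) *s vsh_V j (sph_harm j \<nu>) u
      else 0)"


section \<open>Translation coefficients\<close>

definition irreg_solid :: "nat \<Rightarrow> int \<Rightarrow> real^3 \<Rightarrow> complex" where
  "irreg_solid l m x =
     of_real (sqrt (4 * pi / (2 * real l + 1))) * sph_harm l m (sgn x)
     * of_real (norm x powi (- int l - 1))"

text \<open>Clebsch--Gordan coefficient \<open>\<langle>j1, m1; j2, m2 | j, m\<rangle>\<close> for integer spins, by Racah's formula.
  The sum is over all \<open>k\<close> for which no factorial has a negative argument.\<close>

definition clebsch_gordan :: "nat \<Rightarrow> int \<Rightarrow> nat \<Rightarrow> int \<Rightarrow> nat \<Rightarrow> int \<Rightarrow> real" where
  "clebsch_gordan j1 m1 j2 m2 j m =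
     (let a = int j1; b = int j2; c = int j; F = (\<lambda>n::int. fact (nat n) :: real) in
      if \<bar>m1\<bar> \<le> a \<and> \<bar>m2\<bar> \<le> b \<and> \<bar>m\<bar> \<le> c \<and> m = m1 + m2 \<and> \<bar>a - b\<bar> \<le> c \<and> c \<le> a + b then
        sqrt ((2 * real j + 1) * F (c + a - b) * F (c - a + b) * F (a + b - c) / F (a + b + c + 1))
        * sqrt (F (c + m) * F (c - m) * F (a - m1) * F (a + m1) * F (b - m2) * F (b + m2))
        * (\<Sum>k | 0 \<le> k \<and> k \<le> a + b - c \<and> k \<le> a - m1 \<and> k \<le> b + m2
                 \<and> 0 \<le> c - b + m1 + k \<and> 0 \<le> c - a - m2 + k.
             (-1) powi k / (F k * F (a + b - c - k) * F (a - m1 - k) * F (b + m2 - k)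
                            * F (c - b + m1 + k) * F (c - a - m2 + k)))
      else 0)"

text \<open>\<open>sph_comp_neg a q\<close> is the spherical component of \<open>a\<close> with index \<open>-q\<close>.\<close>

definition sph_comp_neg :: "real^3 \<Rightarrow> int \<Rightarrow> complex" where
  "sph_comp_neg a q =
     (if q = 1 then 1 / of_real (sqrt 2) * (of_real (a$1) - \<i> * of_real (a$2))
      else if q = 0 then of_real (a$3)
      else if q = -1 then - 1 / of_real (sqrt 2) * (of_real (a$1) + \<i> * of_real (a$2))
      else 0)"

definition binom_factor :: "nat \<Rightarrow> nat \<Rightarrow> int \<Rightarrow> int \<Rightarrow> real" where
  "binom_factor l la m \<mu> =
     sqrt (real (nat (int l + int la + \<mu> - m) choose nat (int la + \<mu>))
           * real (nat (int l + int la + m - \<mu>) choose nat (int la - \<mu>)))"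

definition H_coeff :: "nat \<Rightarrow> nat \<Rightarrow> int \<Rightarrow> int \<Rightarrow> real^3 \<Rightarrow> complex" where
  "H_coeff l la m \<mu> a =
     (-1) powi (int la + \<mu>) * of_real (sqrt ((2 * real l + 1) / (2 * real la + 1)))
     * irreg_solid (l + la) (m - \<mu>) a * of_real (binom_factor l la m \<mu>)"

definition L_coeff :: "nat \<Rightarrow> nat \<Rightarrow> nat \<Rightarrow> int \<Rightarrow> int \<Rightarrow> int \<Rightarrow> int \<Rightarrow> real^3 \<Rightarrow> complex" where
  "L_coeff l j la m \<mu> q m1 a =
     \<i> * (-1) powi (int la + \<mu> + q) * of_int (sgn (q - m1)) * sph_comp_neg a q
     * of_real (sqrt (real la * (2 * real l + 1)))
     * irreg_solid (l + la) (m - \<mu>) a * of_real (binom_factor l la m \<mu>)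
     * of_real (clebsch_gordan (la - 1) (\<mu> - m1) 1 m1 la \<mu>)
     * of_real (clebsch_gordan (la - 1) (\<mu> - m1) 1 (q + m1) j (\<mu> + q))"

end

theory Submission
  imports Defs "HOL-Complex_Analysis.Cauchy_Integral_Formula"
begin

text \<open>Put \<open>p = x + \<i>y\<close> and \<open>q = x - \<i>y\<close>, and let \<open>R\<^sub>l\<^sup>m\<close> be the coefficient of \<open>s\<^sup>m\<close> in
  \<open>(z - p s / 2 + q / (2 s))\<^sup>l / l!\<close>. The vector in this linear form is isotropic, so \<open>R\<^sub>l\<^sup>m\<close> is a harmonic
  polynomial; up to the factor \<open>sqrt ((2l+1) / (4\<pi>)) sqrt ((l+m)! (l-m)!)\<close> it is the homogeneous extension of
  \<open>Y\<^sub>l\<^sup>m\<close> (lemma \<open>sph_harm_unit\<close>). In this normalisation differentiation just multiplies the generating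
  function by a monomial in \<open>s\<close>: the derivatives along \<open>z\<close>, \<open>p\<close>, \<open>q\<close> of \<open>R\<^sub>l\<^sup>m\<close> are multiples of
  \<open>R\<^bsub>l-1\<^esub>\<close> of order \<open>m\<close>, \<open>m-1\<close>, \<open>m+1\<close>, by constants that depend neither on \<open>l\<close> nor on \<open>m\<close>. The
  irregular functions \<open>J\<^sub>l\<^sup>m(x) = (l+m)! (l-m)! R\<^sub>l\<^sup>m(x) / |x|\<^bsup>2l+1\<^esup>\<close> obey the same rules up to sign, with the degree going
  up instead of down.

  The surface gradient differs from the full gradient by a radial vector, which the cross product with the
  position removes. Hence \<open>|r'|\<^bsup>-l-1\<^esup> X\<^sub>l\<^sup>m\<close> at \<open>r' = r + a\<close> is a constant times \<open>r' \<times> \<nabla>J\<^sub>l\<^sup>m(r')\<close>.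
  The components of \<open>\<nabla>J\<^sub>l\<^sup>m\<close> are functions \<open>J\<^bsub>l+1\<^esub>\<close>, so the addition theorem \<open>irreg_addition\<close> in degree
  \<open>l + 1\<close> expands the gradient itself, and no series has to be differentiated term by term; after a shift of
  the orders each term of the expansion is \<open>\<nabla>R\<^sub>\<lambda>\<^sup>\<mu>(r)\<close> times \<open>J\<^bsub>l+\<lambda>\<^esub>\<close> at \<open>a\<close> (lemma \<open>grad_term_eq\<close>).
  Splitting \<open>r' \<times> = r \<times> + a \<times>\<close> gives the two sums of the theorem: \<open>r \<times> \<nabla>R\<^sub>\<lambda>\<^sup>\<mu>\<close> is a multiple of
  \<open>X\<^sub>\<lambda>\<^sup>\<mu>\<close>, and \<open>a \<times> \<nabla>R\<^sub>\<lambda>\<^sup>\<mu>\<close> is a combination of products of scalar harmonics of degree \<open>\<lambda> - 1\<close> with the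
  spherical unit vectors, which \<open>vec_Y_recoupling\<close> turns into the harmonics \<open>vec_Y\<close>.

  The addition theorem is the Taylor expansion of \<open>t \<mapsto> J\<^sub>l\<^sup>m(a + t r)\<close> at \<open>0\<close>, evaluated at \<open>t = 1\<close>. The
  recursion of the \<open>R\<^sub>n\<^sup>\<mu>\<close> identifies the Taylor coefficients. Convergence holds because this function
  extends holomorphically to the disc of radius \<open>|a| / |r| > 1\<close>, where \<open>|a + t r|\<close> has a nonvanishing
  holomorphic extension.

  The recoupling rests on the three coefficients \<open>\<langle>k, M; 1, q | j, M+q\<rangle>\<close> with \<open>j = k-1, k, k+1\<close>. Racah's sum
  collapses to one or two terms there, and all square roots cancel against the norming of the harmonics, so
  that only rational identities in \<open>k\<close> and \<open>M\<close> remain. The real orders are a linear combination of the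
  complex orders \<open>m\<close> and \<open>-m\<close> and come along by linearity.\<close>

section \<open>Solid harmonics and their recurrences\<close>

text \<open>The coefficient of \<open>s\<^sup>m\<close> in \<open>(z - p s / 2 + q / (2 s))\<^sup>l / l!\<close>, by peeling off one factor. The arguments
  \<open>p\<close>, \<open>q\<close>, \<open>z\<close> stand for \<open>x + \<i>y\<close>, \<open>x - \<i>y\<close>, \<open>z\<close>, but are independent complex numbers, so that the
  polynomial can be continued to complex points.\<close>

primrec solid :: "nat \<Rightarrow> int \<Rightarrow> complex \<Rightarrow> complex \<Rightarrow> complex \<Rightarrow> complex" where
  "solid 0 m p q z = (if m = 0 then 1 else 0)"
| "solid (Suc l) m p q z =
     (z * solid l m p q z - p / 2 * solid l (m - 1) p q z + q / 2 * solid l (m + 1) p q z) / of_nat (Suc l)"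

text \<open>Degree \<open>l - 1\<close>, with value \<open>0\<close> in degree \<open>-1\<close>; the recurrences and derivative rules below then need no
  exception at \<open>l = 0\<close>.\<close>

definition solid_pred :: "nat \<Rightarrow> int \<Rightarrow> complex \<Rightarrow> complex \<Rightarrow> complex \<Rightarrow> complex" where
  "solid_pred l m p q z = (case l of 0 \<Rightarrow> 0 | Suc k \<Rightarrow> solid k m p q z)"

lemma solid_pred_simps [simp]:
  "solid_pred 0 m p q z = 0" "solid_pred (Suc l) m p q z = solid l m p q z"
  by (auto simp: solid_pred_def)

lemma solid_eq_0: "int l < \<bar>m\<bar> \<Longrightarrow> solid l m p q z = 0"
  by (induction l arbitrary: m) auto

text \<open>The defining recursion, written so that it can be combined with \<open>solid_order\<close> below.\<close>

lemma solid_degree: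
  "of_nat l * solid l m p q z =
     z * solid_pred l m p q z - p / 2 * solid_pred l (m - 1) p q z + q / 2 * solid_pred l (m + 1) p q z"
  by (cases l) (auto simp del: of_nat_Suc)

text \<open>The operator \<open>s d/ds\<close>, which has eigenvalue \<open>m\<close> on \<open>s\<^sup>m\<close>, applied to the generating function.\<close>

lemma solid_order:
  "of_int m * solid l m p q z = - p / 2 * solid_pred l (m - 1) p q z - q / 2 * solid_pred l (m + 1) p q z"
proof (induction l arbitrary: m)
  case (Suc l)
  have S: "of_nat (Suc l) * (of_int m * solid (Suc l) m p q z) = z * (of_int m * solid l m p q z)
      - p / 2 * (of_int (m - 1) * solid l (m - 1) p q z) - p / 2 * solid l (m - 1) p q z
      + q / 2 * (of_int (m + 1) * solid l (m + 1) p q z) - q / 2 * solid l (m + 1) p q z"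
  proof -
    have "of_nat (Suc l) * solid (Suc l) m p q z = z * solid l m p q z - p / 2 * solid l (m - 1) p q z
      + q / 2 * solid l (m + 1) p q z" by (simp del: of_nat_Suc)
    then have "of_nat (Suc l) * (of_int m * solid (Suc l) m p q z) = of_int m * (z * solid l m p q z
      - p / 2 * solid l (m - 1) p q z + q / 2 * solid l (m + 1) p q z)" by (metis mult.left_commute)
    then show ?thesis by (simp only:) (simp add: field_simps)
  qed
  have "of_nat (Suc l) * (of_int m * solid (Suc l) m p q z) =
      - p / 2 * (of_nat l * solid l (m - 1) p q z) - q / 2 * (of_nat l * solid l (m + 1) p q z)
      - p / 2 * solid l (m - 1) p q z - q / 2 * solid l (m + 1) p q z"
    unfolding S Suc.IH solid_degree by (simp add: field_simps)
  also have "\<dots> = of_nat (Suc l) * (- p / 2 * solid l (m - 1) p q z - q / 2 * solid l (m + 1) p q z)"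
    by (simp add: field_simps)
  finally have "of_int m * solid (Suc l) m p q z = - p / 2 * solid l (m - 1) p q z - q / 2 * solid l (m + 1) p q z"
    by (metis mult_cancel_left of_nat_neq_0)
  then show ?case by simp
qed auto

text \<open>The sum and (below) the difference of \<open>solid_degree\<close> and \<open>solid_order\<close>: each involves only two neighbours.\<close>

lemma solid_order_plus:
  "(of_nat l + of_int m) * solid l m p q z = z * solid_pred l m p q z - p * solid_pred l (m - 1) p q z"
  unfolding distrib_right solid_order solid_degree by (simp add: field_simps)

lemma solid_order_minus:
  "(of_nat l - of_int m) * solid l m p q z = z * solid_pred l m p q z + q * solid_pred l (m + 1) p q z"
  unfolding left_diff_distrib solid_order solid_degree by (simp add: field_simps)

text \<open>These three relations say what multiplication by \<open>z\<close>, \<open>p\<close> and \<open>q\<close> does, modulo \<open>z\<^sup>2 + p q\<close>, which is the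
  squared norm at a real point. They are what makes the derivatives of \<open>R\<^sub>l\<^sup>m / |x|\<^bsup>2l+1\<^esup>\<close> single functions
  of degree \<open>l + 1\<close>. Each arises by raising the degree twice, with \<open>solid_order_plus\<close> and \<open>solid_order_minus\<close>.\<close>

lemma solid_three_term:
  "(of_nat l + 1 + of_int m) * (of_nat l + 1 - of_int m) * solid (Suc l) m p q z =
     (2 * of_nat l + 1) * z * solid l m p q z - (z\<^sup>2 + p * q) * solid_pred l m p q z"
proof -
  have 1: "(of_nat l + 1 + of_int m) * solid (Suc l) m p q z = z * solid l m p q z - p * solid l (m - 1) p q z"
    using solid_order_plus[of "Suc l" m p q z] by (simp add: algebra_simps)
  have 2: "(of_nat l + 1 - of_int m) * solid l (m - 1) p q z
      = z * solid_pred l (m - 1) p q z + q * solid_pred l m p q z"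
    using solid_order_minus[of l "m - 1" p q z] by (simp add: algebra_simps)
  note 3 = solid_order_plus[of l m p q z]
  have "(of_nat l + 1 + of_int m) * (of_nat l + 1 - of_int m) * solid (Suc l) m p q z
     = (of_nat l + 1 - of_int m) * ((of_nat l + 1 + of_int m) * solid (Suc l) m p q z)"
    by (simp add: mult_ac)
  also have "\<dots> = (of_nat l + 1 - of_int m) * z * solid l m p q z
     - p * ((of_nat l + 1 - of_int m) * solid l (m - 1) p q z)"
    unfolding 1 by (simp add: algebra_simps)
  finally show ?thesis unfolding 2 using 3 by algebra
qed

lemma solid_three_term_up:
  "(of_nat l + of_int m + 1) * (of_nat l + of_int m + 2) * solid (Suc l) (m + 1) p q z =
     (z\<^sup>2 + p * q) * solid_pred l (m + 1) p q z - (2 * of_nat l + 1) * p * solid l m p q z"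
proof -
  have 1: "(of_nat l + of_int m + 2) * solid (Suc l) (m + 1) p q z = z * solid l (m + 1) p q z - p * solid l m p q z"
    using solid_order_plus[of "Suc l" "m + 1" p q z] by (simp add: algebra_simps)
  have 2: "(of_nat l + of_int m + 1) * solid l (m + 1) p q z
      = z * solid_pred l (m + 1) p q z - p * solid_pred l m p q z"
    using solid_order_plus[of l "m + 1" p q z] by (simp add: algebra_simps)
  note 3 = solid_order_minus[of l m p q z]
  have "(of_nat l + of_int m + 1) * (of_nat l + of_int m + 2) * solid (Suc l) (m + 1) p q z
     = z * ((of_nat l + of_int m + 1) * solid l (m + 1) p q z) - p * (of_nat l + of_int m + 1) * solid l m p q z"
    unfolding mult.assoc 1 by (simp add: algebra_simps)
  then show ?thesis unfolding 2 using 3 by algebra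
qed

lemma solid_three_term_down:
  "(of_nat l - of_int m + 1) * (of_nat l - of_int m + 2) * solid (Suc l) (m - 1) p q z =
     (z\<^sup>2 + p * q) * solid_pred l (m - 1) p q z + (2 * of_nat l + 1) * q * solid l m p q z"
proof -
  have 1: "(of_nat l - of_int m + 2) * solid (Suc l) (m - 1) p q z = z * solid l (m - 1) p q z + q * solid l m p q z"
    using solid_order_minus[of "Suc l" "m - 1" p q z] by (simp add: algebra_simps)
  have 2: "(of_nat l - of_int m + 1) * solid l (m - 1) p q z
      = z * solid_pred l (m - 1) p q z + q * solid_pred l m p q z"
    using solid_order_minus[of l "m - 1" p q z] by (simp add: algebra_simps)
  note 3 = solid_order_plus[of l m p q z]
  have "(of_nat l - of_int m + 1) * (of_nat l - of_int m + 2) * solid (Suc l) (m - 1) p q z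
     = z * ((of_nat l - of_int m + 1) * solid l (m - 1) p q z) + q * (of_nat l - of_int m + 1) * solid l m p q z"
    unfolding mult.assoc 1 by (simp add: algebra_simps)
  then show ?thesis unfolding 2 using 3 by algebra
qed

lemma solid_scale: "solid l m (c * p) (c * q) (c * z) = c ^ l * solid l m p q z"
proof (induction l arbitrary: m)
  case (Suc l)
  show ?case unfolding solid.simps Suc.IH by (simp add: field_simps del: of_nat_Suc)
qed auto

lemma solid_holomorphic:
  assumes "P holomorphic_on S" "Q holomorphic_on S" "Z holomorphic_on S"
  shows "(\<lambda>t. solid l m (P t) (Q t) (Z t)) holomorphic_on S"
  using assms by (induction l arbitrary: m) (auto intro!: holomorphic_intros simp del: of_nat_Suc)

text \<open>Differentiating the generating function in \<open>z\<close>, \<open>p\<close>, \<open>q\<close> multiplies it by \<open>1\<close>, \<open>- s / 2\<close>, \<open>1 / (2 s)\<close> and lowers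
  the degree.\<close>

lemma solid_has_derivative:
  fixes P Q Z :: "'a::real_normed_vector \<Rightarrow> complex"
  assumes "(P has_derivative P') F" "(Q has_derivative Q') F" "(Z has_derivative Z') F"
    and "F = at x within S"
  shows "((\<lambda>t. solid l m (P t) (Q t) (Z t)) has_derivative
     (\<lambda>h. Z' h * solid_pred l m (P x) (Q x) (Z x) - P' h / 2 * solid_pred l (m - 1) (P x) (Q x) (Z x)
         + Q' h / 2 * solid_pred l (m + 1) (P x) (Q x) (Z x))) F"
proof (induction l arbitrary: m)
  case (Suc l)
  note [derivative_intros] = Suc.IH[unfolded assms(4)] assms(1-3)[unfolded assms(4)]
  have D: "((\<lambda>t. (Z t * solid l m (P t) (Q t) (Z t) - P t / 2 * solid l (m - 1) (P t) (Q t) (Z t)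
      + Q t / 2 * solid l (m + 1) (P t) (Q t) (Z t)) / of_nat (Suc l)) has_derivative
     (\<lambda>h. Z' h * solid_pred (Suc l) m (P x) (Q x) (Z x) - P' h / 2 * solid_pred (Suc l) (m - 1) (P x) (Q x) (Z x)
         + Q' h / 2 * solid_pred (Suc l) (m + 1) (P x) (Q x) (Z x))) (at x within S)"
    apply (rule has_derivative_eq_rhs)
     apply (rule derivative_intros | simp del: of_nat_Suc)+
    apply (rule ext)
    subgoal for h
    proof -
      let ?s = "\<lambda>k. solid l k (P x) (Q x) (Z x)"
      have "(Z' h * ?s m - P' h / 2 * ?s (m - 1) + Q' h / 2 * ?s (m + 1)) * of_nat (Suc l) =
         Z' h * (?s m + of_nat l * ?s m) - P' h / 2 * (?s (m - 1) + of_nat l * ?s (m - 1))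
         + Q' h / 2 * (?s (m + 1) + of_nat l * ?s (m + 1))"
        by (simp add: field_simps)
      then show ?thesis
        unfolding solid_degree solid_pred_simps
        by (subst nonzero_divide_eq_eq, metis of_nat_neq_0, simp only:) (simp add: field_simps)
    qed
    done
  show ?case unfolding assms(4) using D by simp
qed (use assms in auto)

section \<open>Rodrigues' formula as a Taylor expansion\<close>

text \<open>Taylor's formula for polynomials.\<close>

lemma coeff_shift_higher_pderiv:
  fixes f :: "real poly"
  shows "fact k * coeff (pcompose f [:x, 1:]) k = poly ((pderiv ^^ k) f) x"
proof -
  have "(pderiv ^^ k) (pcompose f [:x, 1:]) = pcompose ((pderiv ^^ k) f) [:x, 1:]"
    by (induction k) (auto simp: pderiv_pcompose pderiv_pCons)
  then have "coeff ((pderiv ^^ k) (pcompose f [:x, 1:])) 0 = poly ((pderiv ^^ k) f) x"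
    by simp
  then show ?thesis by (simp add: coeff_higher_pderiv pochhammer_fact)
qed

text \<open>The \<open>(l+m)\<close>-th Taylor coefficient at \<open>x\<close> of \<open>(t\<^sup>2 - 1)\<^sup>l / (2\<^sup>l l!)\<close>: the polynomial
  \<open>[:x\<^sup>2 - 1, 2 * x, 1:]\<close> is \<open>(x + h)\<^sup>2 - 1\<close> in the variable \<open>h\<close>. The order \<open>m\<close> may be negative.\<close>

definition rodrigues_coeff :: "nat \<Rightarrow> int \<Rightarrow> real \<Rightarrow> real" where
  "rodrigues_coeff l m x =
     (if int l + m < 0 then 0 else coeff ([:x\<^sup>2 - 1, 2 * x, 1:] ^ l) (nat (int l + m)) / (2 ^ l * fact l))"

lemma rodrigues_coeff_0 [simp]: "rodrigues_coeff 0 m x = (if m = 0 then 1 else 0)"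
  by (auto simp: rodrigues_coeff_def coeff_eq_0)

text \<open>One more factor \<open>(x + h)\<^sup>2 - 1 = (x\<^sup>2 - 1) + 2 x h + h\<^sup>2\<close>.\<close>

lemma rodrigues_coeff_Suc:
  "2 * real (Suc l) * rodrigues_coeff (Suc l) m x =
     (x\<^sup>2 - 1) * rodrigues_coeff l (m + 1) x + 2 * x * rodrigues_coeff l m x + rodrigues_coeff l (m - 1) x"
proof -
  let ?g = "[:x\<^sup>2 - 1, 2 * x, 1:]"
  define c where "c k = (if k < 0 then 0 else coeff (?g ^ l) (nat k))" for k :: int
  have "(if k < 0 then 0 else coeff (?g ^ Suc l) (nat k)) = (x\<^sup>2 - 1) * c k + 2 * x * c (k - 1) + c (k - 2)" for k
  proof -
    have e: "nat (k - 1) = nat k - 1" "nat (k - 2) = nat k - 2" by auto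
    consider "k < 0" | "k = 0" | "k = 1" | "k \<ge> 2" by linarith
    then show ?thesis
    proof cases
      case 4
      then obtain n where "k = int n + 2" by (metis add.commute nonneg_int_cases zle_iff_zadd)
      then show ?thesis by (simp add: c_def nat_add_distrib coeff_pCons eval_nat_numeral e)
    qed (auto simp: c_def coeff_pCons)
  qed
  note r = this[of "int (Suc l) + m"]
  have c: "rodrigues_coeff l k x = c (int l + k) / (2 ^ l * fact l)" for k
    by (auto simp: rodrigues_coeff_def c_def)
  have "2 * real (Suc l) * rodrigues_coeff (Suc l) m x =
    (if int (Suc l) + m < 0 then 0 else coeff (?g ^ Suc l) (nat (int (Suc l) + m))) / (2 ^ l * fact l)"
    by (auto simp: rodrigues_coeff_def divide_simps)
  then show ?thesis unfolding r c by (simp add: field_simps)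
qed

text \<open>\<open>((x + h)\<^sup>2 - 1) / h\<close> is invariant under \<open>h \<mapsto> (x\<^sup>2 - 1) / h\<close>. The induction uses the recursion instead of the
  substitution, so that \<open>x\<^sup>2 = 1\<close>, the case of the poles, is included.\<close>

lemma rodrigues_coeff_reflect:
  "rodrigues_coeff l (- int m) x = (x\<^sup>2 - 1) ^ m * rodrigues_coeff l (int m) x"
proof (induction l arbitrary: m)
  case (Suc l)
  show ?case
  proof (cases m)
    case [simp]: (Suc k)
    have "2 * real (Suc l) * rodrigues_coeff (Suc l) (- int m) x =
      (x\<^sup>2 - 1) ^ m * (2 * real (Suc l) * rodrigues_coeff (Suc l) (int m) x)"
    proof -
      have i: "- int m + 1 = - int k" "- int m - 1 = - int (Suc m)" "int m - 1 = int k"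
        "int m + 1 = int (Suc m)" by auto
      show ?thesis unfolding rodrigues_coeff_Suc i Suc.IH by (simp add: algebra_simps)
    qed
    then show ?thesis by (simp del: of_nat_Suc)
  qed simp
qed auto

lemma poly_higher_pderiv_legendre:
  "poly ((pderiv ^^ m) (legendre_poly l)) x = fact (l + m) * rodrigues_coeff l (int m) x"
proof -
  have "pcompose ([:-1, 0, 1:] ^ n) [:x, 1:] = [:x\<^sup>2 - 1, 2 * x, 1:] ^ n" for n
  proof (induction n)
    case (Suc n)
    have "pcompose [:-1, 0, 1:] [:x, 1:] = [:x\<^sup>2 - 1, 2 * x, 1:]"
      by (simp add: pcompose_pCons power2_eq_square)
    with Suc show ?case by (simp only: power_Suc pcompose_mult)
  qed (simp add: pcompose_1)
  then have "fact (l + m) * coeff ([:x\<^sup>2 - 1, 2 * x, 1:] ^ l) (l + m) = poly ((pderiv ^^ (l + m)) ([:-1, 0, 1:] ^ l)) x"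
    using coeff_shift_higher_pderiv[of "l + m" "[:-1, 0, 1:] ^ l" x] by simp
  moreover have "(pderiv ^^ (l + m)) f = (pderiv ^^ m) ((pderiv ^^ l) f)" for f :: "real poly"
    by (metis add.commute comp_apply funpow_add)
  ultimately show ?thesis
    by (simp add: legendre_poly_def higher_pderiv_smult rodrigues_coeff_def nat_add_distrib)
qed

text \<open>On the unit sphere \<open>z - p s / 2 + q / (2 s)\<close> becomes \<open>((z + h)\<^sup>2 - 1) / (2 h)\<close> for \<open>h = q / s\<close>, because
  \<open>p q = 1 - z\<^sup>2\<close>. The proof compares the two recursions, which avoids dividing by \<open>q\<close>.\<close>

lemma solid_sphere:
  assumes "p * q = 1 - (of_real x)\<^sup>2"
  shows "solid l (int m) p q (of_real x) = (- p) ^ m * of_real (rodrigues_coeff l (int m) x)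
    \<and> solid l (- int m) p q (of_real x) = q ^ m * of_real (rodrigues_coeff l (int m) x)"
proof (induction l arbitrary: m)
  case (Suc l)
  note IH1 = Suc.IH[THEN conjunct1] and IH2 = Suc.IH[THEN conjunct2]
  have *: "of_nat (Suc l) * solid (Suc l) k p q (of_real x) = of_real x * solid l k p q (of_real x)
     - p / 2 * solid l (k - 1) p q (of_real x) + q / 2 * solid l (k + 1) p q (of_real x)" for k
    by (simp del: of_nat_Suc)
  have u: "of_nat (Suc l) * of_real (rodrigues_coeff (Suc l) k x) =
     (((of_real x)\<^sup>2 - 1) * of_real (rodrigues_coeff l (k + 1) x) + 2 * of_real x * of_real (rodrigues_coeff l k x)
      + of_real (rodrigues_coeff l (k - 1) x)) / (2 :: complex)" for k
  proof -
    have "complex_of_real (2 * real (Suc l) * rodrigues_coeff (Suc l) k x) =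
       ((of_real x)\<^sup>2 - 1) * of_real (rodrigues_coeff l (k + 1) x) + 2 * of_real x * of_real (rodrigues_coeff l k x)
      + of_real (rodrigues_coeff l (k - 1) x)"
      unfolding rodrigues_coeff_Suc by simp
    then show ?thesis by (simp add: field_simps)
  qed
  have c: "complex_of_nat (Suc l) \<noteq> 0" by (metis of_nat_neq_0)
  have plus: "solid (Suc l) (int m) p q (of_real x) = (- p) ^ m * of_real (rodrigues_coeff (Suc l) (int m) x)"
  proof (cases m)
    case [simp]: 0
    \<comment> \<open>the recursion at order \<open>0\<close> reaches order \<open>-1\<close>, which \<open>rodrigues_coeff_reflect\<close> brings back to order \<open>1\<close>\<close>
    have r: "rodrigues_coeff l (0 - 1) x = (x\<^sup>2 - 1) * rodrigues_coeff l 1 x"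
      using rodrigues_coeff_reflect[of l 1 x] by simp
    have s: "solid l (0 - 1) p q (of_real x) = q * of_real (rodrigues_coeff l 1 x)"
      "solid l (0 + 1) p q (of_real x) = - p * of_real (rodrigues_coeff l 1 x)"
      "solid l 0 p q (of_real x) = of_real (rodrigues_coeff l 0 x)"
      using IH1[of 1] IH2[of 1] IH1[of 0] by simp_all
    have "complex_of_nat (Suc l) * solid (Suc l) 0 p q (of_real x)
        = of_real x * of_real (rodrigues_coeff l 0 x) - (p * q) * of_real (rodrigues_coeff l 1 x)"
      unfolding * s by (simp add: field_simps)
    also have "\<dots> = of_nat (Suc l) * of_real (rodrigues_coeff (Suc l) 0 x)"
      unfolding u assms r by (simp add: field_simps)
    finally have "complex_of_nat (Suc l) * solid (Suc l) 0 p q (of_real x) = of_nat (Suc l) * of_real (rodrigues_coeff (Suc l) 0 x)" .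
    with c show ?thesis by (simp del: solid.simps of_nat_Suc)
  next
    case [simp]: (Suc k)
    have i: "int m - 1 = int k" "int m + 1 = int (Suc m)" by auto
    have "of_nat (Suc l) * solid (Suc l) (int m) p q (of_real x) =
       (- p) ^ m * (of_real x * of_real (rodrigues_coeff l (int m) x)
         - (p * q) / 2 * of_real (rodrigues_coeff l (int m + 1) x) + of_real (rodrigues_coeff l (int m - 1) x) / 2)"
      unfolding * i IH1 IH2 by (simp add: field_simps)
    also have "\<dots> = (- p) ^ m * (of_nat (Suc l) * of_real (rodrigues_coeff (Suc l) (int m) x))"
      unfolding u assms by (simp add: field_simps)
    finally have "of_nat (Suc l) * solid (Suc l) (int m) p q (of_real x) = (- p) ^ m * (of_nat (Suc l) * of_real (rodrigues_coeff (Suc l) (int m) x))" .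
    with c show ?thesis by (simp only: mult.left_commute[of _ "of_nat (Suc l)"] mult_cancel_left simp_thms)
  qed
  have "solid (Suc l) (- int m) p q (of_real x) = q ^ m * of_real (rodrigues_coeff (Suc l) (int m) x)"
  proof (cases m)
    case [simp]: 0
    show ?thesis using plus by simp
  next
    case [simp]: (Suc k)
    have i: "- int m + 1 = - int k" "- int m - 1 = - int (Suc m)" "int m - 1 = int k" "int m + 1 = int (Suc m)" by auto
    have "of_nat (Suc l) * solid (Suc l) (- int m) p q (of_real x) =
       q ^ m * (of_real x * of_real (rodrigues_coeff l (int m) x)
         - (p * q) / 2 * of_real (rodrigues_coeff l (int m + 1) x) + of_real (rodrigues_coeff l (int m - 1) x) / 2)"
      unfolding * i IH1 IH2 by (simp add: field_simps)
    also have "\<dots> = q ^ m * (of_nat (Suc l) * of_real (rodrigues_coeff (Suc l) (int m) x))"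
      unfolding u assms by (simp add: field_simps)
    finally have "of_nat (Suc l) * solid (Suc l) (- int m) p q (of_real x) = q ^ m * (of_nat (Suc l) * of_real (rodrigues_coeff (Suc l) (int m) x))" .
    with c show ?thesis by (simp only: mult.left_commute[of _ "of_nat (Suc l)"] mult_cancel_left simp_thms)
  qed
  with plus show ?case ..
qed auto

section \<open>Spherical harmonics as restrictions of solid harmonics\<close>

abbreviation solid_at :: "nat \<Rightarrow> int \<Rightarrow> real^3 \<Rightarrow> complex" where
  "solid_at l m x \<equiv> solid l m (Complex (x$1) (x$2)) (Complex (x$1) (- (x$2))) (of_real (x$3))"

abbreviation solid_pred_at :: "nat \<Rightarrow> int \<Rightarrow> real^3 \<Rightarrow> complex" where
  "solid_pred_at l m x \<equiv> solid_pred l m (Complex (x$1) (x$2)) (Complex (x$1) (- (x$2))) (of_real (x$3))"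

text \<open>The squared ratio of the \<open>L\<^sup>2\<close>-norming to the norming by the generating function, apart from the factor
  \<open>(2l+1) / (4\<pi>)\<close> that does not depend on the order.\<close>

definition fact_prod :: "nat \<Rightarrow> int \<Rightarrow> real" where
  "fact_prod l m = fact (nat (int l + m)) * fact (nat (int l - m))"

lemma fact_prod_pos [simp]: "fact_prod l m > 0" by (simp add: fact_prod_def)

definition sqrt_fact_prod :: "nat \<Rightarrow> int \<Rightarrow> real" where
  "sqrt_fact_prod l m = sqrt (fact_prod l m)"

lemma sqrt_fact_prod_square: "sqrt_fact_prod l m * sqrt_fact_prod l m = fact_prod l m"
  by (simp add: sqrt_fact_prod_def less_imp_le)

lemma sqrt_fact_prod_pos [simp]: "sqrt_fact_prod l m > 0"
  by (simp add: sqrt_fact_prod_def fact_prod_def)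

lemma sqrt_fact_prod_uminus [simp]: "sqrt_fact_prod l (- m) = sqrt_fact_prod l m"
  by (simp add: sqrt_fact_prod_def fact_prod_def mult.commute)

lemma norm_sq_vec3: "(norm (x :: real^3))\<^sup>2 = (x$1)\<^sup>2 + (x$2)\<^sup>2 + (x$3)\<^sup>2"
  unfolding power2_norm_eq_inner by (simp add: inner_vec_def sum_3 power2_eq_square)

lemma sph_harm_nonneg_eq:
  assumes "norm u = 1"
  shows "sph_harm_nonneg l m u =
    of_real (sqrt ((2 * real l + 1) / (4 * pi)) * sqrt_fact_prod l (int m)) * solid_at l (int m) u"
proof (cases "m \<le> l")
  case True
  let ?p = "Complex (u$1) (u$2)"
  have n: "(u$1)\<^sup>2 + (u$2)\<^sup>2 = 1 - (u$3)\<^sup>2"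
    using norm_sq_vec3[of u] assms by simp
  have p: "?p = of_real (sqrt (1 - (u$3)\<^sup>2)) * cis (Arg ?p)"
    by (metis cmod_complex_polar complex_norm n rcis_cmod_Arg rcis_def of_real_def scaleR_conv_of_real)
  have pm: "?p ^ m = of_real (sqrt (1 - (u$3)\<^sup>2) ^ m) * cis (real m * Arg ?p)"
    by (subst p) (simp add: power_mult_distrib Complex.DeMoivre)
  have "?p * Complex (u$1) (- (u$2)) = 1 - (of_real (u$3))\<^sup>2"
    by (simp add: complex_eq_iff power2_eq_square n[unfolded power2_eq_square] algebra_simps)
  from solid_sphere[OF this, of l m]
  have s: "solid_at l (int m) u = (-1) ^ m * ?p ^ m * of_real (rodrigues_coeff l (int m) (u$3))"
    by (simp flip: power_minus)
  have f: "sqrt (fact (l - m) / fact (l + m)) * fact (l + m) = sqrt_fact_prod l (int m)"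
  proof -
    have "sqrt (fact (l - m) / fact (l + m)) * fact (l + m)
      = sqrt (fact (l - m) / fact (l + m)) * sqrt ((fact (l + m))\<^sup>2)"
      by simp
    also have "\<dots> = sqrt (fact (l + m) * fact (l - m))"
      unfolding real_sqrt_mult[symmetric] by (simp add: power2_eq_square)
    also have "\<dots> = sqrt_fact_prod l (int m)"
      using True by (simp add: sqrt_fact_prod_def fact_prod_def nat_add_distrib flip: of_nat_diff)
    finally show ?thesis .
  qed
  define A where "A = sqrt ((2 * real l + 1) / (4 * pi))"
  define B where "B = sqrt (fact (l - m) / fact (l + m) :: real)"
  have AB: "sqrt ((2 * real l + 1) / (4 * pi) * (fact (l - m) / fact (l + m))) = A * B"
    unfolding A_def B_def by (rule real_sqrt_mult)
  show ?thesis
    unfolding sph_harm_nonneg_def assoc_legendre_def poly_higher_pderiv_legendre s pm AB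
      A_def[symmetric] f[folded B_def, symmetric]
    by (simp add: mult_ac)
next
  case False
  then have "poly ((pderiv ^^ m) (legendre_poly l)) (u$3) = 0"
    unfolding poly_higher_pderiv_legendre
    by (auto simp: rodrigues_coeff_def nat_add_distrib degree_power_eq intro!: coeff_eq_0)
  then show ?thesis using False by (simp add: sph_harm_nonneg_def assoc_legendre_def solid_eq_0)
qed

text \<open>Conjugation exchanges \<open>p\<close> and \<open>q\<close>, which amounts to \<open>s \<mapsto> - 1 / s\<close> in the generating function.\<close>

lemma solid_at_cnj: "cnj (solid_at l m x) = (-1) powi m * solid_at l (- m) x"
proof (induction l arbitrary: m)
  case (Suc l)
  have c: "cnj (Complex a b) = Complex a (- b)" for a b
    by (simp add: complex_eq_iff)
  have e: "- (m - 1) = - m + 1" "- (m + 1) = - m - 1" by auto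
  show ?case
    unfolding solid.simps complex_cnj_divide complex_cnj_add complex_cnj_diff complex_cnj_mult Suc.IH e c
    by (simp add: power_int_diff power_int_add field_simps del: of_nat_Suc)
qed auto

text \<open>The link with Legendre functions. It also replaces the angle \<open>Arg\<close>, which is discontinuous, by polynomials,
  so that the spherical harmonics are seen to be differentiable at every point of the sphere, including the poles.\<close>

lemma sph_harm_unit:
  assumes "norm u = 1"
  shows "sph_harm l m u = of_real (sqrt ((2 * real l + 1) / (4 * pi)) * sqrt_fact_prod l m) * solid_at l m u"
proof (cases "m \<ge> 0")
  case True
  then show ?thesis using sph_harm_nonneg_eq[OF assms, of l "nat m"] by (simp add: sph_harm_def)
next
  case False
  have "(-1) powi m * ((-1) powi (- m) * (w :: complex)) = w" for w
    by (simp flip: mult.assoc power_int_add)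
  with False show ?thesis using sph_harm_nonneg_eq[OF assms, of l "nat (- m)"]
    by (simp add: sph_harm_def solid_at_cnj mult_ac)
qed

section \<open>Surface gradients and vector spherical harmonics\<close>

text \<open>The vector with components \<open>a\<close>, \<open>b\<close>, \<open>c\<close> in the spherical basis \<open>e\<^sub>1 = - (x + \<i>y) / sqrt 2\<close>, \<open>e\<^sub>0 = z\<close>,
  \<open>e\<^bsub>-1\<^esub> = (x - \<i>y) / sqrt 2\<close> (with \<open>x\<close>, \<open>y\<close>, \<open>z\<close> the Cartesian unit vectors).\<close>

definition sph_vec :: "complex \<Rightarrow> complex \<Rightarrow> complex \<Rightarrow> complex^3" where
  "sph_vec a b c = vector [(c - a) / of_real (sqrt 2), - \<i> * (a + c) / of_real (sqrt 2), b]"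

lemma sph_vec_nth [simp]:
  "sph_vec a b c $ 1 = (c - a) / of_real (sqrt 2)"
  "sph_vec a b c $ 2 = - \<i> * (a + c) / of_real (sqrt 2)"
  "sph_vec a b c $ 3 = b"
  by (simp_all add: sph_vec_def vector_3)

lemma of_real_sqrt2_square [simp]: "of_real (sqrt 2) * of_real (sqrt 2) = (2 :: complex)"
  by (simp flip: of_real_mult)

lemma sph_vec_add: "sph_vec a b c + sph_vec a' b' c' = sph_vec (a + a') (b + b') (c + c')"
  by (simp add: vec_eq_iff forall_3 field_simps)

lemma sph_vec_diff: "sph_vec a b c - sph_vec a' b' c' = sph_vec (a - a') (b - b') (c - c')"
  by (simp add: vec_eq_iff forall_3 field_simps)

lemma sph_vec_scale: "k *s sph_vec a b c = sph_vec (k * a) (k * b) (k * c)"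
  by (simp add: vec_eq_iff forall_3 field_simps)

lemma sph_vec_zero: "sph_vec 0 0 0 = 0"
  by (simp add: vec_eq_iff forall_3)

text \<open>The table \<open>e\<^sub>1 \<times> e\<^sub>0 = \<i> e\<^sub>1\<close>, \<open>e\<^sub>1 \<times> e\<^bsub>-1\<^esub> = \<i> e\<^sub>0\<close>, \<open>e\<^sub>0 \<times> e\<^bsub>-1\<^esub> = \<i> e\<^bsub>-1\<^esub>\<close>.\<close>

lemma ccross_sph_vec:
  "ccross (sph_vec a b c) (sph_vec a' b' c') =
     \<i> *s sph_vec (a * b' - b * a') (a * c' - c * a') (b * c' - c * b')"
proof -
  have s: "(complex_of_real (sqrt 2))\<^sup>2 = 2" by (simp add: power2_eq_square)
  show ?thesis
    apply (simp add: vec_eq_iff forall_3 ccross_def vector_3)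
    apply (simp add: field_simps s)
    done
qed

lemma cvec_sph_vec:
  "cvec x = sph_vec (- Complex (x$1) (- (x$2)) / of_real (sqrt 2)) (of_real (x$3)) (Complex (x$1) (x$2) / of_real (sqrt 2))"
  by (simp add: vec_eq_iff forall_3 cvec_def diff_divide_distrib[symmetric] add_divide_distrib[symmetric] complex_eq_iff)

text \<open>The gradient of \<open>solid_at l m\<close>. In the spherical basis the factors \<open>- 1 / 2\<close> and \<open>1 / 2\<close> of the derivatives
  along \<open>p\<close> and \<open>q\<close> both become \<open>1 / sqrt 2\<close>.\<close>

definition solid_grad :: "nat \<Rightarrow> int \<Rightarrow> real^3 \<Rightarrow> complex^3" where
  "solid_grad l m x = sph_vec (solid_pred_at l (m - 1) x / of_real (sqrt 2)) (solid_pred_at l m x)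
     (solid_pred_at l (m + 1) x / of_real (sqrt 2))"

lemma solid_at_has_derivative:
  "(solid_at l m has_derivative
     (\<lambda>h. of_real (h$3) * solid_pred_at l m x - Complex (h$1) (h$2) / 2 * solid_pred_at l (m - 1) x
         + Complex (h$1) (- (h$2)) / 2 * solid_pred_at l (m + 1) x)) (at x)"
proof (rule solid_has_derivative[OF _ _ _ refl])
  have lin: "(f has_derivative f) (at x)" if "linear f" for f :: "real^3 \<Rightarrow> complex"
    using that by (simp add: linear_conv_bounded_linear bounded_linear_imp_has_derivative)
  show "((\<lambda>x :: real^3. Complex (x$1) (x$2)) has_derivative (\<lambda>h. Complex (h$1) (h$2))) (at x)"
    by (rule lin, rule linearI) (simp_all add: complex_eq_iff)
  show "((\<lambda>x :: real^3. Complex (x$1) (- (x$2))) has_derivative (\<lambda>h. Complex (h$1) (- (h$2)))) (at x)"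
    by (rule lin, rule linearI) (simp_all add: complex_eq_iff)
  show "((\<lambda>x :: real^3. complex_of_real (x$3)) has_derivative (\<lambda>h. of_real (h$3))) (at x)"
    by (rule lin, rule linearI) (simp_all add: complex_eq_iff)
qed

lemma solid_at_derivative_axis:
  "(\<lambda>h. of_real (h$3) * solid_pred_at l m x - Complex (h$1) (h$2) / 2 * solid_pred_at l (m - 1) x
         + Complex (h$1) (- (h$2)) / 2 * solid_pred_at l (m + 1) x) (axis i 1) = solid_grad l m x $ i"
  using exhaust_3[of i]
  by (auto simp: solid_grad_def axis_def Complex_eq diff_divide_distrib[symmetric] add_divide_distrib[symmetric])
     (simp_all add: field_simps)

lemma solid_at_scaleR: "solid_at l m (c *\<^sub>R x) = of_real c ^ l * solid_at l m x"
proof -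
  have "Complex (c * a) (c * b) = of_real c * Complex a b" for a b by (simp add: complex_eq_iff)
  from this this[of _ "- _"] show ?thesis by (simp add: solid_scale del: of_real_mult) (simp add: solid_scale)
qed

definition sph_const :: "nat \<Rightarrow> int \<Rightarrow> real" where
  "sph_const l m = sqrt ((2 * real l + 1) / (4 * pi)) * sqrt_fact_prod l m"

lemma sph_harm_sgn:
  assumes "x \<noteq> 0"
  shows "sph_harm l m (sgn x) = of_real (sph_const l m) * solid_at l m x * of_real (inverse (norm x) ^ l)"
  using sph_harm_unit[of "sgn x" l m] assms solid_at_scaleR[of l m "inverse (norm x)" x]
  by (simp add: sph_const_def norm_sgn sgn_div_norm)

text \<open>Near a unit vector \<open>sph_harm l m (sgn x)\<close> is a homogeneous polynomial divided by \<open>|x|\<^sup>l\<close>; the denominator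
  contributes the term with \<open>u \<bullet> h\<close>.\<close>

lemma sph_harm_has_derivative:
  assumes u: "norm u = 1"
  shows "((\<lambda>x. sph_harm l m (sgn x)) has_derivative
    (\<lambda>h. of_real (sph_const l m) * ((of_real (h$3) * solid_pred_at l m u - Complex (h$1) (h$2) / 2 * solid_pred_at l (m - 1) u
         + Complex (h$1) (- (h$2)) / 2 * solid_pred_at l (m + 1) u)
       - of_nat l * solid_at l m u * of_real (u \<bullet> h)))) (at u)"
proof -
  have u0: "u \<noteq> 0" using u by auto
  have n: "(norm has_derivative (\<lambda>h. u \<bullet> h)) (at u)"
    using has_derivative_norm[OF u0] u by (simp add: sgn_div_norm inner_commute)
  have inv: "((\<lambda>x :: real^3. inverse (norm x)) has_derivative (\<lambda>h. - (u \<bullet> h))) (at u)"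
    using Deriv.has_derivative_inverse[OF _ n] u by (simp add: u0)
  have pw: "((\<lambda>x :: real^3. inverse (norm x) ^ l) has_derivative (\<lambda>h. - of_nat l * (u \<bullet> h))) (at u)"
    using has_derivative_power[OF inv, of l] u by simp
  have "((\<lambda>x. of_real (sph_const l m) * solid_at l m x * of_real (inverse (norm x) ^ l)) has_derivative
    (\<lambda>h. of_real (sph_const l m) * ((of_real (h$3) * solid_pred_at l m u - Complex (h$1) (h$2) / 2 * solid_pred_at l (m - 1) u
         + Complex (h$1) (- (h$2)) / 2 * solid_pred_at l (m + 1) u)
       - of_nat l * solid_at l m u * of_real (u \<bullet> h)))) (at u)"
    apply (rule has_derivative_eq_rhs)
     apply (rule has_derivative_mult[OF has_derivative_mult_right[OF solid_at_has_derivative] has_derivative_of_real[OF pw]])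
    using u by (simp add: fun_eq_iff algebra_simps)
  then show ?thesis
    by (rule has_derivative_transform_within_open[of _ _ _ _ "- {0}"]) (use u0 in \<open>auto simp: sph_harm_sgn\<close>)
qed

lemma surf_grad_sph_harm:
  assumes u: "norm u = 1"
  shows "surf_grad (sph_harm l m) u =
    of_real (sph_const l m) *s (solid_grad l m u - (of_nat l * solid_at l m u) *s cvec u)"
  unfolding surf_grad_def frechet_derivative_at[OF sph_harm_has_derivative[OF u], symmetric]
    solid_at_derivative_axis
  by (simp add: vec_eq_iff cvec_def inner_axis algebra_simps)

lemma sph_harm_unit_const: 
  assumes u: "norm u = 1"
  shows "sph_harm l m u = of_real (sph_const l m) * solid_at l m u"
  using sph_harm_unit[OF u] by (simp add: sph_const_def)

lemma ccross_linear:
  "ccross v (w + w') = ccross v w + ccross v w'" "ccross v (w - w') = ccross v w - ccross v w'"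
  "ccross (v + v') w = ccross v w + ccross v' w"
  "ccross v (c *s w) = c *s ccross v w" "ccross (c *s v) w = c *s ccross v w" "ccross v v = 0"
  by (simp_all add: vec_eq_iff forall_3 ccross_def vector_3 algebra_simps)

text \<open>\<open>W\<close> is the full gradient of the regular solid harmonic, and \<open>V\<close> that of the irregular one; the radial
  part drops out of \<open>X\<close>.\<close>

lemma vsh_sph_harm:
  assumes u: "norm u = 1"
  shows "vsh_W l (sph_harm l m) u = of_real (sph_const l m) *s solid_grad l m u"
    and "vsh_X l (sph_harm l m) u = of_real (sph_const l m) *s ccross (cvec u) (solid_grad l m u)"
    and "vsh_V l (sph_harm l m) u =
      of_real (sph_const l m) *s (solid_grad l m u - ((2 * of_nat l + 1) * solid_at l m u) *s cvec u)"
    unfolding vsh_W_def vsh_X_def vsh_V_def surf_grad_sph_harm[OF u] sph_harm_unit_const[OF u]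
    by (simp_all add: ccross_linear) (simp_all add: vec_eq_iff algebra_simps)

text \<open>Up to the factor \<open>\<i>\<close> these are the angular momentum operators: they preserve the degree and shift the order by
  at most one.\<close>

lemma ccross_cvec_solid_grad:
  "ccross (cvec x) (solid_grad l m x) = \<i> *s sph_vec
     (- (of_nat l - of_int m + 1) / of_real (sqrt 2) * solid_at l (m - 1) x)
     (of_int m * solid_at l m x)
     ((of_nat l + of_int m + 1) / of_real (sqrt 2) * solid_at l (m + 1) x)"
proof -
  let ?p = "Complex (x$1) (x$2)" and ?q = "Complex (x$1) (- (x$2))" and ?z = "complex_of_real (x$3)"
  have 1: "(of_nat l - of_int m + 1) * solid_at l (m - 1) x = ?z * solid_pred_at l (m - 1) x + ?q * solid_pred_at l m x"
    using solid_order_minus[of l "m - 1" ?p ?q ?z] by (simp add: algebra_simps)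
  have 2: "(of_nat l + of_int m + 1) * solid_at l (m + 1) x = ?z * solid_pred_at l (m + 1) x - ?p * solid_pred_at l m x"
    using solid_order_plus[of l "m + 1" ?p ?q ?z] by (simp add: algebra_simps)
  show ?thesis
    unfolding cvec_sph_vec solid_grad_def ccross_sph_vec times_divide_eq_left minus_mult_left[symmetric] 1 2 solid_order
    by (rule arg_cong[of _ _ "\<lambda>v. \<i> *s v"], rule arg_cong3[of _ _ _ _ _ _ sph_vec])
       (simp_all add: field_simps)
qed

text \<open>The left side is \<open>|x|\<^bsup>2l+3\<^esup>\<close> times the gradient of \<open>R\<^sub>l\<^sup>m / |x|\<^bsup>2l+1\<^esup>\<close>. By the three-term relations its
  components are multiples of harmonics of degree \<open>l + 1\<close>.\<close>

lemma solid_grad_irregular: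
  "of_real ((norm x)\<^sup>2) *s solid_grad l m x - ((2 * of_nat l + 1) * solid_at l m x) *s cvec x = sph_vec
     ((of_nat l - of_int m + 1) * (of_nat l - of_int m + 2) / of_real (sqrt 2) * solid_at (Suc l) (m - 1) x)
     (- (of_nat l + 1 + of_int m) * (of_nat l + 1 - of_int m) * solid_at (Suc l) m x)
     ((of_nat l + of_int m + 1) * (of_nat l + of_int m + 2) / of_real (sqrt 2) * solid_at (Suc l) (m + 1) x)"
proof -
  let ?p = "Complex (x$1) (x$2)" and ?q = "Complex (x$1) (- (x$2))" and ?z = "complex_of_real (x$3)"
  have n: "?z\<^sup>2 + ?p * ?q = of_real ((norm x)\<^sup>2)"
    unfolding norm_sq_vec3 by (simp add: complex_eq_iff power2_eq_square algebra_simps)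
  show ?thesis
    unfolding cvec_sph_vec solid_grad_def sph_vec_scale sph_vec_diff times_divide_eq_left minus_mult_left[symmetric]
      solid_three_term solid_three_term_up solid_three_term_down n
    by (rule arg_cong3[of _ _ _ _ _ _ sph_vec]) (simp_all add: field_simps)
qed

section \<open>Irregular solid harmonics and their addition theorem\<close>

text \<open>The factors on the left are those of the three-term relations.\<close>

lemma fact_prod_Suc:
  assumes "\<bar>m\<bar> \<le> int l"
  shows "(real l + 1 + of_int m) * (real l + 1 - of_int m) * fact_prod l m = fact_prod (Suc l) m"
    and "(real l - of_int m + 1) * (real l - of_int m + 2) * fact_prod l m = fact_prod (Suc l) (m - 1)"
    and "(real l + of_int m + 1) * (real l + of_int m + 2) * fact_prod l m = fact_prod (Suc l) (m + 1)"
proof -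
  define a b where "a = nat (int l + m)" and "b = nat (int l - m)"
  have ab: "real l + of_int m = real a" "real l - of_int m = real b"
    using assms by (simp_all add: a_def b_def)
  have e: "nat (int (Suc l) + m) = Suc a" "nat (int (Suc l) - m) = Suc b" "nat (int (Suc l) + (m - 1)) = a"
    "nat (int (Suc l) - (m - 1)) = Suc (Suc b)" "nat (int (Suc l) + (m + 1)) = Suc (Suc a)"
    "nat (int (Suc l) - (m + 1)) = b"
    using assms by (auto simp: a_def b_def)
  have 0: "fact_prod l m = fact a * fact b" by (simp add: fact_prod_def a_def b_def)
  have 1: "real l + 1 + of_int m = real a + 1" "real l + 1 - of_int m = real b + 1" using ab by auto
  show "(real l + 1 + of_int m) * (real l + 1 - of_int m) * fact_prod l m = fact_prod (Suc l) m"
    unfolding 0 1 by (simp only: fact_prod_def e) (simp add: algebra_simps)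
  show "(real l - of_int m + 1) * (real l - of_int m + 2) * fact_prod l m = fact_prod (Suc l) (m - 1)"
    unfolding 0 ab by (simp only: fact_prod_def e) (simp add: algebra_simps)
  show "(real l + of_int m + 1) * (real l + of_int m + 2) * fact_prod l m = fact_prod (Suc l) (m + 1)"
    unfolding 0 ab by (simp only: fact_prod_def e) (simp add: algebra_simps)
qed

text \<open>With the factor \<open>fact_prod\<close> the derivative rules have the same constants as for \<open>solid\<close>, up to sign.\<close>

definition irreg :: "nat \<Rightarrow> int \<Rightarrow> real^3 \<Rightarrow> complex" where
  "irreg l m x = of_real (fact_prod l m / norm x ^ (2 * l + 1)) * solid_at l m x"

lemma powi_minus_Suc: "x powi (- int l - 1) = inverse (x :: real) ^ Suc l"
proof -
  have "- int l - 1 = - int (Suc l)" by simp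
  then show ?thesis by (simp only: power_int_minus power_int_of_nat power_inverse)
qed

lemma irreg_eq_irreg_solid: "x \<noteq> 0 \<Longrightarrow> irreg l m x = of_real (sqrt_fact_prod l m) * irreg_solid l m x"
proof -
  assume x: "x \<noteq> 0"
  have 1: "sqrt (4 * pi / (2 * real l + 1)) * sqrt ((2 * real l + 1) / (4 * pi)) = 1"
    by (simp flip: real_sqrt_mult)
  note 2 = powi_minus_Suc[of "norm x" l]
  have "of_real (sqrt_fact_prod l m) * irreg_solid l m x =
    of_real (sqrt_fact_prod l m * sqrt_fact_prod l m * (sqrt (4 * pi / (2 * real l + 1)) * sqrt ((2 * real l + 1) / (4 * pi)))
      * (inverse (norm x) ^ l * inverse (norm x) ^ Suc l)) * solid_at l m x"
    unfolding irreg_solid_def sph_harm_sgn[OF x] sph_const_def 2 by (simp add: mult_ac del: power_Suc)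
  also have "\<dots> = irreg l m x"
    unfolding sqrt_fact_prod_square 1 irreg_def power_add[symmetric]
    by (simp add: divide_inverse power_inverse mult_2 del: power_Suc)
  finally show ?thesis ..
qed

text \<open>The factor \<open>fact_prod\<close> absorbs the coefficients of the three-term relations. Outside \<open>\<bar>m\<bar> \<le> l\<close> the rule fails:
  the left side is then \<open>0\<close>, but \<open>irreg (Suc l) (m - 1)\<close> need not vanish.\<close>

lemma irreg_has_derivative:
  assumes x: "x \<noteq> 0" and m: "\<bar>m\<bar> \<le> int l"
  shows "(irreg l m has_derivative (\<lambda>h. - of_real (h$3) * irreg (Suc l) m x - Complex (h$1) (h$2) / 2 * irreg (Suc l) (m - 1) x
     + Complex (h$1) (- (h$2)) / 2 * irreg (Suc l) (m + 1) x)) (at x)"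
proof -
  let ?p = "Complex (x$1) (x$2)" and ?q = "Complex (x$1) (- (x$2))" and ?z = "complex_of_real (x$3)"
  let ?n = "norm x"
  let ?N = "complex_of_real ?n"
  have n: "?z\<^sup>2 + ?p * ?q = ?N\<^sup>2"
    unfolding of_real_power[symmetric] norm_sq_vec3 by (simp add: complex_eq_iff power2_eq_square algebra_simps)
  have n0: "?N \<noteq> 0" using x by simp
  have inv: "((\<lambda>x :: real^3. inverse (norm x)) has_derivative (\<lambda>h. - (x \<bullet> h) / norm x ^ 3)) (at x)"
    using Deriv.has_derivative_inverse[OF _ has_derivative_norm[OF x]] x
    by (simp add: sgn_div_norm inner_commute field_simps power3_eq_cube)
  have pw: "((\<lambda>x :: real^3. inverse (norm x) ^ (2 * l + 1)) has_derivative
      (\<lambda>h. - (2 * real l + 1) * (x \<bullet> h) * inverse ?n ^ (2 * l + 3))) (at x)"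
    by (rule has_derivative_eq_rhs[OF has_derivative_power[OF inv]])
       (use x in \<open>simp add: fun_eq_iff field_simps power_add power3_eq_cube\<close>)
  have in3: "complex_of_real (x \<bullet> h) = ?z * of_real (h$3) + (?p * Complex (h$1) (- (h$2)) + ?q * Complex (h$1) (h$2)) / 2" for h
    by (simp add: inner_vec_def sum_3 complex_eq_iff)
  have D: "((\<lambda>x. of_real (fact_prod l m) * solid_at l m x * of_real (inverse (norm x) ^ (2 * l + 1))) has_derivative
    (\<lambda>h. of_real (fact_prod l m) * of_real (inverse ?n ^ (2 * l + 3)) * (?N\<^sup>2 * (of_real (h$3) * solid_pred_at l m x
         - Complex (h$1) (h$2) / 2 * solid_pred_at l (m - 1) x
         + Complex (h$1) (- (h$2)) / 2 * solid_pred_at l (m + 1) x)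
       - (2 * of_nat l + 1) * solid_at l m x * of_real (x \<bullet> h)))) (at x)"
    apply (rule has_derivative_eq_rhs)
     apply (rule has_derivative_mult[OF has_derivative_mult_right[OF solid_at_has_derivative] has_derivative_of_real[OF pw]])
    using n0 by (simp add: fun_eq_iff field_simps power_add power2_eq_square power3_eq_cube)
  have S: "irreg (Suc l) k x = of_real (fact_prod (Suc l) k) * of_real (inverse ?n ^ (2 * l + 3)) * solid_at (Suc l) k x" for k
  proof -
    have e: "2 * Suc l + 1 = 2 * l + 3" by simp
    show ?thesis unfolding irreg_def e by (simp add: divide_inverse power_inverse mult_ac del: solid.simps)
  qed
  have c: "complex_of_real (fact_prod (Suc l) m) * solid_at (Suc l) m x
       = of_real (fact_prod l m) * ((2 * of_nat l + 1) * ?z * solid_at l m x - ?N\<^sup>2 * solid_pred_at l m x)"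
    "complex_of_real (fact_prod (Suc l) (m - 1)) * solid_at (Suc l) (m - 1) x
       = of_real (fact_prod l m) * (?N\<^sup>2 * solid_pred_at l (m - 1) x + (2 * of_nat l + 1) * ?q * solid_at l m x)"
    "complex_of_real (fact_prod (Suc l) (m + 1)) * solid_at (Suc l) (m + 1) x
       = of_real (fact_prod l m) * (?N\<^sup>2 * solid_pred_at l (m + 1) x - (2 * of_nat l + 1) * ?p * solid_at l m x)"
    unfolding fact_prod_Suc[OF m, symmetric] n[symmetric] solid_three_term[symmetric] solid_three_term_up[symmetric]
      solid_three_term_down[symmetric]
    by (simp_all del: solid.simps)
  have "(irreg l m has_derivative (\<lambda>h. of_real (fact_prod l m) * of_real (inverse ?n ^ (2 * l + 3)) * (?N\<^sup>2 * (of_real (h$3) * solid_pred_at l m x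
         - Complex (h$1) (h$2) / 2 * solid_pred_at l (m - 1) x
         + Complex (h$1) (- (h$2)) / 2 * solid_pred_at l (m + 1) x)
       - (2 * of_nat l + 1) * solid_at l m x * of_real (x \<bullet> h)))) (at x)"
    by (rule has_derivative_transform_within_open[OF D, of "- {0}"])
       (use x in \<open>auto simp: irreg_def divide_inverse power_inverse mult_ac\<close>)
  then show ?thesis
  proof (rule has_derivative_eq_rhs, intro ext)
    fix h :: "real^3"
    define i where "i = complex_of_real (inverse ?n ^ (2 * l + 3))"
    have "- of_real (h$3) * irreg (Suc l) m x - Complex (h$1) (h$2) / 2 * irreg (Suc l) (m - 1) x
     + Complex (h$1) (- (h$2)) / 2 * irreg (Suc l) (m + 1) x =
      i * (- of_real (h$3) * (complex_of_real (fact_prod (Suc l) m) * solid_at (Suc l) m x)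
      - Complex (h$1) (h$2) / 2 * (complex_of_real (fact_prod (Suc l) (m - 1)) * solid_at (Suc l) (m - 1) x)
      + Complex (h$1) (- (h$2)) / 2 * (complex_of_real (fact_prod (Suc l) (m + 1)) * solid_at (Suc l) (m + 1) x))"
      unfolding S i_def[symmetric] by (simp add: field_simps del: solid.simps)
    then show "of_real (fact_prod l m) * complex_of_real (inverse ?n ^ (2 * l + 3)) * (?N\<^sup>2 * (of_real (h$3) * solid_pred_at l m x
         - Complex (h$1) (h$2) / 2 * solid_pred_at l (m - 1) x
         + Complex (h$1) (- (h$2)) / 2 * solid_pred_at l (m + 1) x)
       - (2 * of_nat l + 1) * solid_at l m x * of_real (x \<bullet> h)) =
      - of_real (h$3) * irreg (Suc l) m x - Complex (h$1) (h$2) / 2 * irreg (Suc l) (m - 1) x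
     + Complex (h$1) (- (h$2)) / 2 * irreg (Suc l) (m + 1) x"
      unfolding c in3 i_def[symmetric] by (simp add: field_simps)
  qed
qed

lemma irreg_line_derivative:
  assumes x: "a + t *\<^sub>R r \<noteq> 0" and m: "\<bar>m\<bar> \<le> int l"
  shows "((\<lambda>t. irreg l m (a + t *\<^sub>R r)) has_vector_derivative
      - of_real (r$3) * irreg (Suc l) m (a + t *\<^sub>R r) - Complex (r$1) (r$2) / 2 * irreg (Suc l) (m - 1) (a + t *\<^sub>R r)
     + Complex (r$1) (- (r$2)) / 2 * irreg (Suc l) (m + 1) (a + t *\<^sub>R r)) (at t)"
proof -
  have "((\<lambda>t. a + t *\<^sub>R r) has_derivative (\<lambda>h. h *\<^sub>R r)) (at t)"
    by (auto intro!: derivative_eq_intros)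
  from has_derivative_compose[OF this irreg_has_derivative[OF x m]]
  show ?thesis unfolding has_vector_derivative_def
    by (rule has_derivative_eq_rhs)
       (simp add: fun_eq_iff scaleR_conv_of_real[where 'a = complex] Complex_eq field_simps)
qed

text \<open>The polynomial \<open>|a + t r|\<^sup>2 / |a|\<^sup>2\<close> factors as \<open>(1 - w t) (1 - cnj w t)\<close> with \<open>|w| = |r| / |a|\<close>. For
  \<open>|t| < 1 / |w|\<close> both factors have positive real part, so the principal square roots are holomorphic; for real
  \<open>t\<close> they are conjugate, so their product is positive.\<close>

lemma holomorphic_norm_line:
  fixes a r :: "real^3"
  assumes ar: "norm r < norm a" and r: "0 < norm r"
  obtains G where "G holomorphic_on ball 0 (norm a / norm r)"
    and "\<And>t. t \<in> ball 0 (norm a / norm r) \<Longrightarrow> G t \<noteq> 0"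
    and "\<And>t. \<bar>t\<bar> < norm a / norm r \<Longrightarrow> G (of_real t) = of_real (norm (a + t *\<^sub>R r))"
proof -
  define b c where "b = (a \<bullet> r) / (norm a)\<^sup>2" and "c = (norm r)\<^sup>2 / (norm a)\<^sup>2"
  have a0: "norm a > 0" using ar r by linarith
  have "(a \<bullet> r)\<^sup>2 \<le> (norm a)\<^sup>2 * (norm r)\<^sup>2"
    using Cauchy_Schwarz_ineq[of a r] by (simp add: power2_norm_eq_inner)
  then have cb: "b\<^sup>2 \<le> c" unfolding b_def c_def using a0
    by (simp add: field_simps power2_eq_square)
  \<comment> \<open>\<open>1 + 2 b t + c t\<^sup>2\<close> has nonreal or double roots by Cauchy--Schwarz; \<open>w\<close> is the inverse of one of them\<close>
  define w where "w = Complex (- b) (sqrt (c - b\<^sup>2))"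
  have "(norm w)\<^sup>2 = c" using cb by (simp add: w_def cmod_power2)
  then have nw: "norm w = norm r / norm a" using a0
    by (metis c_def norm_ge_zero power_divide power2_eq_imp_eq divide_nonneg_nonneg)
  have re: "0 < Re (1 - w' * t)" if "t \<in> ball 0 (norm a / norm r)" "norm w' = norm w" for t w' :: complex
  proof -
    have "norm (w' * t) < 1" using that r a0 unfolding norm_mult that(2) nw
      by (simp add: field_simps)
    then show ?thesis using complex_Re_le_cmod[of "w' * t"] by simp
  qed
  have np: "1 - w' * t \<notin> \<real>\<^sub>\<le>\<^sub>0" if "t \<in> ball 0 (norm a / norm r)" "norm w' = norm w" for t w' :: complex
    using re[OF that] by (auto simp: complex_nonpos_Reals_iff)
  define G where "G t = of_real (norm a) * (csqrt (1 - w * t) * csqrt (1 - cnj w * t))" for t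
  show thesis
  proof
    show "G holomorphic_on ball 0 (norm a / norm r)"
      unfolding G_def by (intro holomorphic_intros) (use np in auto)
    show "G t \<noteq> 0" if "t \<in> ball 0 (norm a / norm r)" for t
    proof -
      have "1 - w * t \<noteq> 0" "1 - cnj w * t \<noteq> 0"
        using re[OF that, of w] re[OF that, of "cnj w"] by (metis complex_mod_cnj less_irrefl zero_complex.sel(1))+
      then show ?thesis using a0 by (simp only: G_def mult_eq_0_iff csqrt_eq_0 of_real_eq_0_iff) simp
    qed
    show "G (of_real t) = of_real (norm (a + t *\<^sub>R r))" if t: "\<bar>t\<bar> < norm a / norm r" for t
    proof -
      have tb: "complex_of_real t \<in> ball 0 (norm a / norm r)" using t by simp
      have "csqrt (1 - cnj w * of_real t) = cnj (csqrt (1 - w * of_real t))"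
        using cnj_csqrt[OF np[OF tb refl]] by simp
      then have "csqrt (1 - w * of_real t) * csqrt (1 - cnj w * of_real t) = of_real ((norm (csqrt (1 - w * of_real t)))\<^sup>2)"
        by (simp only: complex_norm_square)
      also have "\<dots> = of_real (norm (1 - w * of_real t))" by simp
      finally have 1: "G (of_real t) = of_real (norm a * norm (1 - w * of_real t))" by (simp add: G_def)
      have "(norm (1 - w * of_real t))\<^sup>2 = 1 + 2 * b * t + c * t\<^sup>2"
        using cb by (simp add: cmod_power2 w_def power_mult_distrib) (simp add: power2_eq_square algebra_simps)
      moreover have "(norm (a + t *\<^sub>R r))\<^sup>2 = (norm a)\<^sup>2 + 2 * t * (a \<bullet> r) + t\<^sup>2 * (norm r)\<^sup>2"
        unfolding power2_norm_eq_inner by (simp add: inner_add_left inner_add_right inner_commute power2_eq_square algebra_simps)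
      moreover have "(norm a)\<^sup>2 * (1 + 2 * b * t + c * t\<^sup>2) = (norm a)\<^sup>2 + 2 * t * (a \<bullet> r) + t\<^sup>2 * (norm r)\<^sup>2"
        using a0 by (simp add: b_def c_def field_simps)
      ultimately have "(norm a * norm (1 - w * of_real t))\<^sup>2 = (norm (a + t *\<^sub>R r))\<^sup>2"
        by (simp only: power_mult_distrib)
      then have "norm a * norm (1 - w * of_real t) = norm (a + t *\<^sub>R r)"
        by (simp add: power2_eq_iff_nonneg)
      with 1 show ?thesis by simp
    qed
  qed
qed

text \<open>Lets the order of the summation index be shifted by one without boundary terms, at the cost of a wider range.\<close>

lemma sum_symmetric_shift:
  fixes f :: "int \<Rightarrow> 'a::comm_monoid_add"
  assumes "\<bar>c\<bar> \<le> 1" and "\<And>\<mu>. \<bar>\<mu>\<bar> > int n \<Longrightarrow> f \<mu> = 0"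
  shows "(\<Sum>\<mu>\<in>{- int n..int n}. f \<mu>) = (\<Sum>\<mu>\<in>{- int (Suc n)..int (Suc n)}. f (\<mu> + c))"
proof -
  have "(\<Sum>\<mu>\<in>{- int (Suc n)..int (Suc n)}. f (\<mu> + c)) = sum f ((\<lambda>\<mu>. \<mu> + c) ` {- int (Suc n)..int (Suc n)})"
    by (subst sum.reindex) (auto simp: inj_on_def)
  also have "\<dots> = (\<Sum>\<mu>\<in>{- int n..int n}. f \<mu>)"
  proof (rule sum.mono_neutral_right)
    show "{- int n..int n} \<subseteq> (\<lambda>\<mu>. \<mu> + c) ` {- int (Suc n)..int (Suc n)}"
    proof
      fix \<mu> assume "\<mu> \<in> {- int n..int n}"
      then show "\<mu> \<in> (\<lambda>\<mu>. \<mu> + c) ` {- int (Suc n)..int (Suc n)}"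
        using assms(1) by (intro image_eqI[of _ _ "\<mu> - c"]) auto
    qed
  qed (use assms(2) in force)+
  finally show ?thesis ..
qed

text \<open>The \<open>n\<close>-th term of the addition theorem. It is \<open>(r \<bullet> \<nabla>)\<^sup>n / n!\<close> applied to \<open>irreg l m\<close> at \<open>x\<close>: the derivative
  along \<open>r\<close> acts on the orders like the linear form \<open>- z - p s / 2 + q / (2 s)\<close>, which is the negative of the one
  in the generating function with \<open>- s\<close> for \<open>s\<close>; this explains the sign.\<close>

definition irreg_taylor :: "nat \<Rightarrow> int \<Rightarrow> nat \<Rightarrow> real^3 \<Rightarrow> real^3 \<Rightarrow> complex" where
  "irreg_taylor l m n r x = (\<Sum>\<mu>\<in>{- int n..int n}. (-1) powi (int n + \<mu>) * solid_at n \<mu> r * irreg (l + n) (m - \<mu>) x)"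

lemma irreg_taylor_derivative:
  assumes x: "a + t *\<^sub>R r \<noteq> 0" and m: "\<bar>m\<bar> \<le> int l"
  shows "((\<lambda>t. irreg_taylor l m n r (a + t *\<^sub>R r)) has_vector_derivative
     of_nat (Suc n) * irreg_taylor l m (Suc n) r (a + t *\<^sub>R r)) (at t)"
proof -
  let ?p = "Complex (r$1) (r$2)" and ?q = "Complex (r$1) (- (r$2))" and ?z = "complex_of_real (r$3)"
  let ?x = "a + t *\<^sub>R r"
  define c where "c \<mu> = (-1) powi (int n + \<mu>) * solid_at n \<mu> r" for \<mu>
  define J where "J k = irreg (Suc (l + n)) k ?x" for k
  have c0: "c \<mu> = 0" if "\<bar>\<mu>\<bar> > int n" for \<mu> using solid_eq_0[of n \<mu>] that by (simp add: c_def)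
  have "((\<lambda>t. irreg_taylor l m n r (a + t *\<^sub>R r)) has_vector_derivative
     (\<Sum>\<mu>\<in>{- int n..int n}. c \<mu> * (- ?z * J (m - \<mu>) - ?p / 2 * J (m - \<mu> - 1) + ?q / 2 * J (m - \<mu> + 1)))) (at t)"
    unfolding irreg_taylor_def c_def J_def
    by (intro has_vector_derivative_sum has_vector_derivative_mult_right irreg_line_derivative x) (use m in auto)
  also have "(\<Sum>\<mu>\<in>{- int n..int n}. c \<mu> * (- ?z * J (m - \<mu>) - ?p / 2 * J (m - \<mu> - 1) + ?q / 2 * J (m - \<mu> + 1)))
    = (\<Sum>\<mu>\<in>{- int n..int n}. c \<mu> * (- ?z * J (m - \<mu>))) + (\<Sum>\<mu>\<in>{- int n..int n}. c \<mu> * (- ?p / 2 * J (m - \<mu> - 1)))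
     + (\<Sum>\<mu>\<in>{- int n..int n}. c \<mu> * (?q / 2 * J (m - \<mu> + 1)))"
    unfolding sum.distrib[symmetric] by (intro sum.cong refl) (simp add: algebra_simps)
  also have "\<dots> = (\<Sum>\<mu>\<in>{- int (Suc n)..int (Suc n)}. c (\<mu> + 0) * (- ?z * J (m - (\<mu> + 0))))
     + (\<Sum>\<mu>\<in>{- int (Suc n)..int (Suc n)}. c (\<mu> + - 1) * (- ?p / 2 * J (m - (\<mu> + - 1) - 1)))
     + (\<Sum>\<mu>\<in>{- int (Suc n)..int (Suc n)}. c (\<mu> + 1) * (?q / 2 * J (m - (\<mu> + 1) + 1)))"
    using c0 sum_symmetric_shift[of 0 n "\<lambda>\<mu>. c \<mu> * (- ?z * J (m - \<mu>))"]
      sum_symmetric_shift[of "-1" n "\<lambda>\<mu>. c \<mu> * (- ?p / 2 * J (m - \<mu> - 1))"]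
      sum_symmetric_shift[of 1 n "\<lambda>\<mu>. c \<mu> * (?q / 2 * J (m - \<mu> + 1))"] by simp
  also have "\<dots> = (\<Sum>\<mu>\<in>{- int (Suc n)..int (Suc n)}. (- ?z * c \<mu> - ?p / 2 * c (\<mu> - 1) + ?q / 2 * c (\<mu> + 1)) * J (m - \<mu>))"
    unfolding sum.distrib[symmetric] by (intro sum.cong refl) (simp add: algebra_simps)
  also have "\<dots> = (\<Sum>\<mu>\<in>{- int (Suc n)..int (Suc n)}. of_nat (Suc n) * ((-1) powi (int (Suc n) + \<mu>) * solid_at (Suc n) \<mu> r) * J (m - \<mu>))"
  proof (intro sum.cong refl arg_cong2[of _ _ _ _ times])
    fix \<mu>
    have s: "(-1) powi (int (Suc n) + \<mu>) = - ((-1) powi (int n + \<mu>) :: complex)"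
      "(-1) powi (int n + (\<mu> - 1)) = - ((-1) powi (int n + \<mu>) :: complex)"
      "(-1) powi (int n + (\<mu> + 1)) = - ((-1) powi (int n + \<mu>) :: complex)"
      by (simp_all add: power_int_add power_int_diff)
    have "of_nat (Suc n) * ((-1) powi (int (Suc n) + \<mu>) * solid_at (Suc n) \<mu> r) =
       - ((-1) powi (int n + \<mu>)) * (?z * solid_at n \<mu> r - ?p / 2 * solid_at n (\<mu> - 1) r + ?q / 2 * solid_at n (\<mu> + 1) r)"
      unfolding s by (simp add: field_simps del: of_nat_Suc)
    show "- ?z * c \<mu> - ?p / 2 * c (\<mu> - 1) + ?q / 2 * c (\<mu> + 1) =
        of_nat (Suc n) * ((-1) powi (int (Suc n) + \<mu>) * solid_at (Suc n) \<mu> r)"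
      unfolding \<open>of_nat (Suc n) * _ = _\<close> unfolding c_def s by (simp add: field_simps del: of_nat_Suc solid.simps)
  qed
  also have "\<dots> = of_nat (Suc n) * irreg_taylor l m (Suc n) r ?x"
    unfolding irreg_taylor_def J_def sum_distrib_left by (simp add: mult_ac del: of_nat_Suc solid.simps)
  finally show ?thesis .
qed

text \<open>The term of index \<open>n\<close> collects all contributions homogeneous of degree \<open>n\<close> in \<open>r\<close>, hence the series is the power
  series of a holomorphic function of \<open>t\<close> at \<open>t = 1\<close>.\<close>

theorem irreg_addition:
  assumes ar: "norm r < norm a" and r: "0 < norm r" and m: "\<bar>m\<bar> \<le> int l"
  shows "(\<lambda>n. irreg_taylor l m n r a) sums irreg l m (r + a)"
proof -
  define R where "R = norm a / norm r"
  have R1: "R > 1" using ar r by (simp add: R_def)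
  obtain G where G: "G holomorphic_on ball 0 R" "\<And>t. t \<in> ball 0 R \<Longrightarrow> G t \<noteq> 0"
    "\<And>t. \<bar>t\<bar> < R \<Longrightarrow> G (of_real t) = of_real (norm (a + t *\<^sub>R r))"
    using holomorphic_norm_line[OF ar r] unfolding R_def by blast
  define F where "F t = of_real (fact_prod l m) / G t ^ (2 * l + 1) *
     solid l m (Complex (a$1) (a$2) + t * Complex (r$1) (r$2)) (Complex (a$1) (- (a$2)) + t * Complex (r$1) (- (r$2)))
       (of_real (a$3) + t * of_real (r$3))" for t
  have hol: "F holomorphic_on ball 0 R"
    unfolding F_def by (intro holomorphic_intros solid_holomorphic) (use G in auto)
  have F: "F (of_real t) = irreg l m (a + t *\<^sub>R r)" if "\<bar>t\<bar> < R" for t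
  proof -
    have e: "Complex (a$1) (a$2) + of_real t * Complex (r$1) (r$2) = Complex ((a + t *\<^sub>R r)$1) ((a + t *\<^sub>R r)$2)"
      "Complex (a$1) (- (a$2)) + of_real t * Complex (r$1) (- (r$2)) = Complex ((a + t *\<^sub>R r)$1) (- (a + t *\<^sub>R r)$2)"
      "complex_of_real (a$3) + of_real t * of_real (r$3) = of_real ((a + t *\<^sub>R r)$3)"
      by (simp_all add: complex_eq_iff)
    show ?thesis unfolding F_def irreg_def e G(3)[OF that] by simp
  qed
  have nz: "a + t *\<^sub>R r \<noteq> 0" if "\<bar>t\<bar> < R" for t
    using G(2)[of "of_real t"] G(3)[OF that] that by auto
  \<comment> \<open>on the real segment the complex derivative is the derivative along the line\<close>
  have D: "(deriv ^^ n) F (of_real t) = fact n * irreg_taylor l m n r (a + t *\<^sub>R r)" if "\<bar>t\<bar> < R" for t n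
    using that
  proof (induction n arbitrary: t)
    case 0
    then show ?case by (simp add: F irreg_taylor_def)
  next
    case (Suc n)
    have tb: "complex_of_real t \<in> ball 0 R" using Suc.prems by simp
    have "(deriv ^^ n) F holomorphic_on ball 0 R"
      using hol by (rule holomorphic_higher_deriv) auto
    then have "((deriv ^^ n) F has_field_derivative deriv ((deriv ^^ n) F) (of_real t)) (at (of_real t))"
      using tb by (metis holomorphic_derivI open_ball)
    from has_vector_derivative_real_field[OF this]
    have 1: "((\<lambda>t. (deriv ^^ n) F (of_real t)) has_vector_derivative (deriv ^^ Suc n) F (of_real t)) (at t)"
      by simp
    have "((\<lambda>t. fact n * irreg_taylor l m n r (a + t *\<^sub>R r)) has_vector_derivative
       fact n * (of_nat (Suc n) * irreg_taylor l m (Suc n) r (a + t *\<^sub>R r))) (at t)"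
      by (intro has_vector_derivative_mult_right irreg_taylor_derivative nz m Suc.prems)
    then have 2: "((\<lambda>t. (deriv ^^ n) F (of_real t)) has_vector_derivative
       fact n * (of_nat (Suc n) * irreg_taylor l m (Suc n) r (a + t *\<^sub>R r))) (at t)"
      by (rule has_vector_derivative_transform_within_open[of _ _ _ "{-R<..<R}"])
         (use Suc in \<open>auto simp: abs_less_iff\<close>)
    from vector_derivative_unique_at[OF 1 2] show ?case by (simp add: mult_ac)
  qed
  have "(\<lambda>n. (deriv ^^ n) F 0 / fact n * (1 - 0) ^ n) sums F 1"
    by (rule holomorphic_power_series[OF hol]) (use R1 in auto)
  moreover have "(deriv ^^ n) F 0 / fact n * (1 - 0) ^ n = irreg_taylor l m n r a" for n
    using D[of 0 n] R1 by simp
  moreover have "F 1 = irreg l m (r + a)" using F[of 1] R1 by (simp add: add.commute)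
  ultimately show ?thesis by simp
qed

section \<open>Clebsch--Gordan coefficients with a spin one factor\<close>

lemma sqrt_fact_prod_nonzero [simp]: "sqrt_fact_prod l m \<noteq> 0"
  using sqrt_fact_prod_pos[of l m] by linarith

text \<open>The alternating sum in Racah's formula, without the square roots in front.\<close>

definition racah_sum :: "nat \<Rightarrow> int \<Rightarrow> nat \<Rightarrow> int \<Rightarrow> nat \<Rightarrow> real" where
  "racah_sum a m1 b m2 c =
    (\<Sum>k | 0 \<le> k \<and> k \<le> int a + int b - int c \<and> k \<le> int a - m1 \<and> k \<le> int b + m2
                 \<and> 0 \<le> int c - int b + m1 + k \<and> 0 \<le> int c - int a - m2 + k.
             (-1) powi k / (fact (nat k) * fact (nat (int a + int b - int c - k)) * fact (nat (int a - m1 - k)) * fact (nat (int b + m2 - k))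
                            * fact (nat (int c - int b + m1 + k)) * fact (nat (int c - int a - m2 + k))))"

lemma clebsch_gordan_racah:
  assumes "\<bar>m1\<bar> \<le> int a" "\<bar>m2\<bar> \<le> int b" "\<bar>m1 + m2\<bar> \<le> int c" "\<bar>int a - int b\<bar> \<le> int c" "c \<le> a + b"
  shows "clebsch_gordan a m1 b m2 c (m1 + m2) =
    sqrt ((2 * real c + 1) * fact (nat (int c + int a - int b)) * fact (nat (int c - int a + int b))
       * fact (nat (int a + int b - int c)) / fact (a + b + c + 1))
    * (sqrt_fact_prod c (m1 + m2) * sqrt_fact_prod a m1 * sqrt_fact_prod b m2) * racah_sum a m1 b m2 c"
proof -
  have 1: "nat (int a + int b + int c + 1) = a + b + c + 1" by simp
  have 2: "int c \<le> int a + int b" using assms(5) by simp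
  have 3: "sqrt (fact (nat (int c + (m1 + m2))) * fact (nat (int c - (m1 + m2))) * fact (nat (int a - m1)) * fact (nat (int a + m1))
      * fact (nat (int b - m2)) * fact (nat (int b + m2))) = sqrt_fact_prod c (m1 + m2) * sqrt_fact_prod a m1 * sqrt_fact_prod b m2"
    unfolding sqrt_fact_prod_def fact_prod_def real_sqrt_mult[symmetric] by (simp add: mult_ac)
  show ?thesis unfolding clebsch_gordan_def Let_def 1 3 racah_sum_def using assms 2 by simp
qed

lemma clebsch_gordan_1_upper:
  assumes "\<bar>M\<bar> \<le> int k" "\<bar>q\<bar> \<le> 1"
  shows "clebsch_gordan k M 1 q (Suc k) (M + q) =
     sqrt_fact_prod (Suc k) (M + q) / (sqrt ((real k + 1) * (2 * real k + 1)) * sqrt_fact_prod k M * sqrt_fact_prod 1 q)"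
proof -
  have s: "{i. 0 \<le> i \<and> i \<le> int k + int 1 - int (Suc k) \<and> i \<le> int k - M \<and> i \<le> int 1 + q
                 \<and> 0 \<le> int (Suc k) - int 1 + M + i \<and> 0 \<le> int (Suc k) - int k - q + i} = {0}"
    using assms by auto
  have S: "racah_sum k M 1 q (Suc k) = 1 / ((sqrt_fact_prod k M * sqrt_fact_prod k M) * (sqrt_fact_prod 1 q * sqrt_fact_prod 1 q))"
    unfolding racah_sum_def s sqrt_fact_prod_square by (simp add: fact_prod_def mult_ac)
  have e: "nat (int (Suc k) + int k - int 1) = 2 * k" "nat (int (Suc k) - int k + int 1) = 2"
    "nat (int k + int 1 - int (Suc k)) = 0" "k + 1 + Suc k + 1 = Suc (Suc (Suc (2 * k)))" by auto
  have f: "(2 * real (Suc k) + 1) * fact (2 * k) * fact 2 * fact 0 / fact (Suc (Suc (Suc (2 * k)))) =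
     1 / ((real k + 1) * (2 * real k + 1))"
    by (simp add: divide_simps) (simp add: algebra_simps)
  have "clebsch_gordan k M 1 q (Suc k) (M + q) = sqrt (1 / ((real k + 1) * (2 * real k + 1)))
     * (sqrt_fact_prod (Suc k) (M + q) * sqrt_fact_prod k M * sqrt_fact_prod 1 q) * racah_sum k M 1 q (Suc k)"
    using clebsch_gordan_racah[of M k q 1 "Suc k"] assms unfolding e f by simp
  then show ?thesis unfolding S real_sqrt_divide by (simp add: field_simps)
qed

text \<open>Only the summation indices \<open>0\<close> and \<open>1\<close> can occur, and both do only for \<open>q = 0\<close>, \<open>\<bar>M\<bar> < k\<close>. The factor \<open>sqrt_fact_prod k (M + q)\<close>
  is the one that \<open>vec_Y\<close> carries; it clears all factorials.\<close>

lemma clebsch_gordan_1_middle: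
  assumes "\<bar>M\<bar> \<le> int k" "\<bar>q\<bar> \<le> 1" "k > 0" "\<bar>M + q\<bar> \<le> int k"
  shows "clebsch_gordan k M 1 q k (M + q) * sqrt_fact_prod k (M + q) =
     sqrt_fact_prod k M * sqrt_fact_prod 1 q / (2 * sqrt (real k * (real k + 1)))
      * (if q = 1 then - (real k + of_int M + 1) else if q = 0 then 2 * of_int M else real k - of_int M + 1)"
proof -
  obtain n where n: "k = Suc n" using assms(3) by (cases k) auto
  have e: "nat (int k + int k - int 1) = 2 * n + 1" "nat (int k - int k + int 1) = 1"
    "nat (int k + int 1 - int k) = 1" "k + 1 + k + 1 = Suc (Suc (Suc (2 * n + 1)))" using n by auto
  have f: "(2 * real k + 1) * fact (2 * n + 1) * fact 1 * fact 1 / fact (Suc (Suc (Suc (2 * n + 1)))) =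
     1 / (2\<^sup>2 * (real k * (real k + 1)))"
    by (simp add: n divide_simps) (simp add: algebra_simps power2_eq_square)
  have "clebsch_gordan k M 1 q k (M + q) = sqrt (1 / (2\<^sup>2 * (real k * (real k + 1)))) * (sqrt_fact_prod k (M + q) * sqrt_fact_prod k M * sqrt_fact_prod 1 q) * racah_sum k M 1 q k"
    using clebsch_gordan_racah[of M k q 1 k] assms unfolding e f by simp
  then have c: "clebsch_gordan k M 1 q k (M + q) = 1 / (2 * sqrt (real k * (real k + 1))) * (sqrt_fact_prod k (M + q) * sqrt_fact_prod k M * sqrt_fact_prod 1 q) * racah_sum k M 1 q k"
    by (simp add: real_sqrt_divide real_sqrt_mult)
  have F: "fact (nat x) = of_int x * (fact (nat (x - 1)) :: real)" if "x \<ge> 1" for x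
  proof -
    have "nat x = Suc (nat (x - 1))" using that by simp
    then show ?thesis using that by (simp only: fact_Suc) simp
  qed
  have "fact_prod k (M + q) * racah_sum k M 1 q k = (if q = 1 then - (real k + of_int M + 1) else if q = 0 then 2 * of_int M else real k - of_int M + 1)"
  proof -
    let ?S = "{i. 0 \<le> i \<and> i \<le> int k + int 1 - int k \<and> i \<le> int k - M \<and> i \<le> int 1 + q
                 \<and> 0 \<le> int k - int 1 + M + i \<and> 0 \<le> int k - int k - q + i}"
    consider "q = 1" | "q = -1" | "q = 0" "M = int k" | "q = 0" "M = - int k" | "q = 0" "\<bar>M\<bar> < int k"
      using assms by linarith
    then show ?thesis
    proof cases
      case 1
      then have s: "?S = {1}" using assms by auto
      have "fact_prod k (M + q) = (real k + of_int M + 1) * (fact (nat (int k + M)) * fact (nat (int k - M - 1)))"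
        using F[of "int k + M + 1"] assms 1 by (simp add: fact_prod_def algebra_simps)
      moreover have "racah_sum k M 1 q k = - 1 / (fact (nat (int k + M)) * fact (nat (int k - M - 1)))"
        unfolding racah_sum_def s using 1 by (simp add: algebra_simps)
      ultimately show ?thesis using 1 by simp
    next
      case 2
      then have s: "?S = {0}" using assms by auto
      have "fact_prod k (M + q) = (real k - of_int M + 1) * (fact (nat (int k - M)) * fact (nat (int k + M - 1)))"
      proof -
        have "fact_prod k (M + q) = fact (nat (int k - M + 1)) * fact (nat (int k + M - 1))"
          using 2 by (simp add: fact_prod_def algebra_simps)
        then show ?thesis using F[of "int k - M + 1"] assms by simp
      qed
      moreover have "racah_sum k M 1 q k = 1 / (fact (nat (int k - M)) * fact (nat (int k + M - 1)))"
        unfolding racah_sum_def s using 2 by (simp add: algebra_simps)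
      ultimately show ?thesis using 2 by simp
    next
      case 3
      then have s: "?S = {0}" using assms by auto
      show ?thesis unfolding racah_sum_def s fact_prod_def using 3 assms(3) F[of "2 * int k"] by (simp add: algebra_simps)
    next
      case 4
      then have s: "?S = {1}" using assms by auto
      show ?thesis unfolding racah_sum_def s fact_prod_def using 4 assms(3) F[of "2 * int k"] by (simp add: algebra_simps)
    next
      case 5
      then have s: "?S = {0, 1}" using assms by auto
      define X Y A B where "X = real k + of_int M" and "Y = real k - of_int M"
        and "A = (fact (nat (int k + M - 1)) :: real)" and "B = (fact (nat (int k - M - 1)) :: real)"
      have nz: "X \<noteq> 0" "Y \<noteq> 0" "A \<noteq> 0" "B \<noteq> 0"
        using 5 unfolding X_def Y_def A_def B_def by (linarith | simp)+
      have fX: "fact (nat (int k + M)) = X * A" and fY: "fact (nat (int k - M)) = Y * B"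
        using F[of "int k - M"] F[of "int k + M"] 5 by (simp_all add: X_def Y_def A_def B_def)
      have "fact_prod k (M + q) = (X * A) * (Y * B)"
        unfolding fX[symmetric] fY[symmetric] using 5 by (simp add: fact_prod_def)
      moreover have "racah_sum k M 1 q k = 1 / (Y * B * A) - 1 / (B * (X * A))"
        unfolding racah_sum_def s fX[symmetric] fY[symmetric] unfolding A_def B_def using 5 by (simp add: algebra_simps)
      moreover have "(X * A) * (Y * B) * (1 / (Y * B * A) - 1 / (B * (X * A))) = X - Y"
        using nz by (simp add: field_simps)
      ultimately show ?thesis using 5 by (simp add: X_def Y_def)
    qed
  qed
  then show ?thesis unfolding c sqrt_fact_prod_square[symmetric] by (simp add: field_simps)
qed

lemma clebsch_gordan_1_lower:
  assumes "\<bar>M\<bar> \<le> int (Suc n)" "\<bar>q\<bar> \<le> 1" "\<bar>M + q\<bar> \<le> int n"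
  shows "clebsch_gordan (Suc n) M 1 q n (M + q) * sqrt_fact_prod n (M + q) =
     sqrt_fact_prod (Suc n) M / (sqrt (real (Suc n) * (2 * real n + 3)) * sqrt_fact_prod 1 q) * (-1) powi (1 + q)"
proof -
  have s: "{i. 0 \<le> i \<and> i \<le> int (Suc n) + int 1 - int n \<and> i \<le> int (Suc n) - M \<and> i \<le> int 1 + q
                 \<and> 0 \<le> int n - int 1 + M + i \<and> 0 \<le> int n - int (Suc n) - q + i} = {1 + q}"
    using assms by auto
  have S: "racah_sum (Suc n) M 1 q n = (-1) powi (1 + q) / ((sqrt_fact_prod n (M + q) * sqrt_fact_prod n (M + q)) * (sqrt_fact_prod 1 q * sqrt_fact_prod 1 q))"
    unfolding racah_sum_def s sqrt_fact_prod_square by (simp add: fact_prod_def algebra_simps)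
  have e: "nat (int n + int (Suc n) - int 1) = 2 * n" "nat (int n - int (Suc n) + int 1) = 0"
    "nat (int (Suc n) + int 1 - int n) = 2" "Suc n + 1 + n + 1 = Suc (Suc (Suc (2 * n)))"  by auto
  have f: "(2 * real n + 1) * fact (2 * n) * fact 0 * fact 2 / fact (Suc (Suc (Suc (2 * n)))) =
     1 / (real (Suc n) * (2 * real n + 3))"
    by (simp add: divide_simps) (simp add: algebra_simps)
  have "clebsch_gordan (Suc n) M 1 q n (M + q) = sqrt (1 / (real (Suc n) * (2 * real n + 3))) * (sqrt_fact_prod n (M + q) * sqrt_fact_prod (Suc n) M * sqrt_fact_prod 1 q)
     * racah_sum (Suc n) M 1 q n"
    using clebsch_gordan_racah[of M "Suc n" q 1 n] assms unfolding e f by simp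
  then show ?thesis unfolding S real_sqrt_divide by (simp add: field_simps)
qed

text \<open>The spherical basis vector \<open>e\<^sub>q\<close>, and \<open>0\<close> when \<open>\<bar>q\<bar> > 1\<close>.\<close>

definition sph_unit :: "int \<Rightarrow> complex^3" where
  "sph_unit q = sph_vec (of_bool (q = 1)) (of_bool (q = 0)) (of_bool (q = -1))"

lemma sqrt_fact_prod_1 [simp]: "sqrt_fact_prod (Suc 0) 1 = sqrt 2" "sqrt_fact_prod (Suc 0) (- 1) = sqrt 2" "sqrt_fact_prod (Suc 0) 0 = 1"
  by (simp_all add: sqrt_fact_prod_def fact_prod_def)

lemma sqrt_fact_prod_Suc_ratio:
  assumes "\<bar>M\<bar> \<le> int k" "\<bar>q\<bar> \<le> 1"
  shows "sqrt_fact_prod (Suc k) (M + q) * sqrt_fact_prod (Suc k) (M + q) = sqrt_fact_prod k M * sqrt_fact_prod k M *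
     (if q = 1 then (real k + of_int M + 1) * (real k + of_int M + 2)
      else if q = 0 then (real k + 1 + of_int M) * (real k + 1 - of_int M)
      else (real k - of_int M + 1) * (real k - of_int M + 2))"
proof -
  have "q = 1 \<or> q = 0 \<or> q = -1" using assms(2) by linarith
  then show ?thesis unfolding sqrt_fact_prod_square using fact_prod_Suc[OF assms(1)] by (auto simp: mult.commute[of "fact_prod k M"])
qed

lemma solid_grad_eq_0: "int l < \<bar>m\<bar> \<Longrightarrow> solid_grad l m x = 0"
  by (cases l) (auto simp: solid_grad_def solid_eq_0 sph_vec_zero)

lemma clebsch_gordan_eq_0: "int j < \<bar>m\<bar> \<Longrightarrow> clebsch_gordan a m1 b m2 j m = 0"
  by (simp add: clebsch_gordan_def)

text \<open>Here and in the next two lemmas the square roots of the Clebsch--Gordan coefficient combine with the norming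
  of \<open>vec_Y\<close>. Apart from \<open>sph_const k M\<close> and \<open>sqrt_fact_prod 1 q\<close>, which is \<open>1\<close> or \<open>sqrt 2\<close>, the result is rational.\<close>

lemma recouple_upper:
  assumes u: "norm u = 1" and M: "\<bar>M\<bar> \<le> int k" and q: "\<bar>q\<bar> \<le> 1"
  shows "of_real (clebsch_gordan k M 1 q (Suc k) (M + q)) *s vec_Y (Suc k) k (M + q) u =
     of_real (sph_const k M / sqrt_fact_prod 1 q / ((real k + 1) * (2 * real k + 1)) *
     (if q = 1 then (real k + of_int M + 1) * (real k + of_int M + 2)
      else if q = 0 then (real k + 1 + of_int M) * (real k + 1 - of_int M)
      else (real k - of_int M + 1) * (real k - of_int M + 2))) *s solid_grad (Suc k) (M + q) u"
proof -
  let ?P = "(if q = 1 then (real k + of_int M + 1) * (real k + of_int M + 2)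
      else if q = 0 then (real k + 1 + of_int M) * (real k + 1 - of_int M)
      else (real k - of_int M + 1) * (real k - of_int M + 2))"
  define s1 s2 s3 where "s1 = sqrt (real k + 1)" and "s2 = sqrt (2 * real k + 1)" and "s3 = sqrt (2 * real k + 3)"
  have ss: "s1 * s1 = real k + 1" "s2 * s2 = 2 * real k + 1" "s1 \<noteq> 0" "s2 \<noteq> 0" "s3 \<noteq> 0"
    by (simp_all add: s1_def s2_def s3_def add_nonneg_eq_0_iff)
  have "clebsch_gordan k M 1 q (Suc k) (M + q) * (1 / sqrt ((real k + 1) * (2 * (real k + 1) + 1))) * sph_const (Suc k) (M + q)
     = sph_const k M / sqrt_fact_prod 1 q / ((real k + 1) * (2 * real k + 1)) * ?P"
  proof -
    have a: "2 * (real k + 1) + 1 = 2 * real k + 3" "2 * real (Suc k) + 1 = 2 * real k + 3" by auto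
    have "clebsch_gordan k M 1 q (Suc k) (M + q) * (1 / sqrt ((real k + 1) * (2 * (real k + 1) + 1))) * sph_const (Suc k) (M + q)
      = (sqrt_fact_prod (Suc k) (M + q) * sqrt_fact_prod (Suc k) (M + q)) / (s1 * s2 * sqrt_fact_prod k M * sqrt_fact_prod 1 q * (s1 * s3)) * (s3 / sqrt (4 * pi))"
      unfolding clebsch_gordan_1_upper[OF M q] a sph_const_def real_sqrt_mult[symmetric] real_sqrt_divide
      by (simp add: s1_def s2_def s3_def real_sqrt_mult)
    also have "\<dots> = (s2 / sqrt (4 * pi) * sqrt_fact_prod k M) / sqrt_fact_prod 1 q / ((s1 * s1) * (s2 * s2)) * ?P"
      unfolding sqrt_fact_prod_Suc_ratio[OF M q] using ss(3-5) by (simp add: field_simps)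
    finally show ?thesis unfolding ss(1,2) by (simp add: sph_const_def s2_def real_sqrt_divide)
  qed
  then have "complex_of_real (clebsch_gordan k M 1 q (Suc k) (M + q) * (1 / sqrt ((real k + 1) * (2 * (real k + 1) + 1))) * sph_const (Suc k) (M + q)) *s solid_grad (Suc k) (M + q) u
     = of_real (sph_const k M / sqrt_fact_prod 1 q / ((real k + 1) * (2 * real k + 1)) * ?P) *s solid_grad (Suc k) (M + q) u"
    by (simp only:)
  then show ?thesis
    by (simp add: vec_Y_def vsh_sph_harm[OF u] mult.assoc)
qed

text \<open>For \<open>\<bar>M + q\<bar> > k\<close> both sides are \<open>0\<close>.\<close>

lemma recouple_middle:
  assumes u: "norm u = 1" and M: "\<bar>M\<bar> \<le> int k" and q: "\<bar>q\<bar> \<le> 1" and k: "k > 0"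
  shows "of_real (clebsch_gordan k M 1 q k (M + q)) *s vec_Y k k (M + q) u =
     (- \<i> * of_real (sph_const k M * sqrt_fact_prod 1 q / (2 * real k * (real k + 1)) *
      (if q = 1 then - (real k + of_int M + 1) else if q = 0 then 2 * of_int M else real k - of_int M + 1)))
      *s ccross (cvec u) (solid_grad k (M + q) u)"
proof (cases "\<bar>M + q\<bar> \<le> int k")
  case False
  then show ?thesis by (simp add: clebsch_gordan_eq_0 solid_grad_eq_0 ccross_def vec_eq_iff forall_3 vector_3)
next
  case True
  let ?P = "(if q = 1 then - (real k + of_int M + 1) else if q = 0 then 2 * of_int M else real k - of_int M + 1)"
  define s where "s = sqrt (real k * (real k + 1))"
  have ss: "s * s = real k * (real k + 1)" using k by (simp add: s_def)
  have "clebsch_gordan k M 1 q k (M + q) * (1 / s) * sph_const k (M + q)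
     = (sqrt ((2 * real k + 1) / (4 * pi)) / s) * (clebsch_gordan k M 1 q k (M + q) * sqrt_fact_prod k (M + q))"
    by (simp add: sph_const_def)
  also have "\<dots> = sph_const k M * sqrt_fact_prod 1 q / (2 * (s * s)) * ?P"
    unfolding clebsch_gordan_1_middle[OF M q k True] s_def[symmetric] sph_const_def by (simp only: times_divide_times_eq times_divide_eq_left times_divide_eq_right divide_divide_eq_left mult_ac)
  finally have key: "clebsch_gordan k M 1 q k (M + q) * (1 / s) * sph_const k (M + q) = sph_const k M * sqrt_fact_prod 1 q / (2 * real k * (real k + 1)) * ?P"
    unfolding ss by (simp only: mult.assoc)
  have "of_real (clebsch_gordan k M 1 q k (M + q)) *s vec_Y k k (M + q) u =
    (- \<i> * of_real (clebsch_gordan k M 1 q k (M + q) * (1 / s) * sph_const k (M + q))) *s ccross (cvec u) (solid_grad k (M + q) u)"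
    by (simp add: vec_Y_def vsh_sph_harm[OF u] s_def mult_ac)
  then show ?thesis unfolding key .
qed

lemma recouple_lower:
  assumes u: "norm u = 1" and M: "\<bar>M\<bar> \<le> int (Suc n)" and q: "\<bar>q\<bar> \<le> 1"
  shows "of_real (clebsch_gordan (Suc n) M 1 q n (M + q)) *s vec_Y n (Suc n) (M + q) u =
     of_real (sph_const (Suc n) M / sqrt_fact_prod 1 q / (real (Suc n) * (2 * real n + 3)) * (-1) powi (1 + q)) *s
      (solid_grad n (M + q) u - ((2 * of_nat n + 1) * solid_at n (M + q) u) *s cvec u)"
proof (cases "\<bar>M + q\<bar> \<le> int n")
  case False
  then show ?thesis by (simp add: clebsch_gordan_eq_0 solid_grad_eq_0 solid_eq_0)
next
  case True
  define s1 s2 s3 where "s1 = sqrt (real (Suc n))" and "s2 = sqrt (2 * real n + 1)" and "s3 = sqrt (2 * real n + 3)"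
  have ss: "s1 * s1 = real (Suc n)" "s3 * s3 = 2 * real n + 3" "s1 \<noteq> 0" "s2 \<noteq> 0" "s3 \<noteq> 0"
    by (simp_all add: s1_def s2_def s3_def add_nonneg_eq_0_iff)
  have "clebsch_gordan (Suc n) M 1 q n (M + q) * (1 / (s1 * s2)) * sph_const n (M + q)
     = (s2 / sqrt (4 * pi) / (s1 * s2)) * (clebsch_gordan (Suc n) M 1 q n (M + q) * sqrt_fact_prod n (M + q))"
    by (simp add: sph_const_def s2_def real_sqrt_divide)
  also have "\<dots> = (s3 / sqrt (4 * pi) * sqrt_fact_prod (Suc n) M) / sqrt_fact_prod 1 q / ((s1 * s1) * (s3 * s3)) * (-1) powi (1 + q)"
    unfolding clebsch_gordan_1_lower[OF M q True] real_sqrt_mult s1_def[symmetric] s3_def[symmetric]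
    using ss(3-5) by (simp add: field_simps)
  also have "s3 / sqrt (4 * pi) * sqrt_fact_prod (Suc n) M = sph_const (Suc n) M"
    by (simp add: sph_const_def s3_def real_sqrt_divide add.commute)
  finally have "complex_of_real (clebsch_gordan (Suc n) M 1 q n (M + q) * (1 / (s1 * s2)) * sph_const n (M + q)) *s v
     = of_real (sph_const (Suc n) M / sqrt_fact_prod 1 q / (real (Suc n) * (2 * real n + 3)) * (-1) powi (1 + q)) *s v" for v :: "complex^3"
    unfolding ss by (simp only:)
  note E = this[of "solid_grad n (M + q) u - ((2 * of_nat n + 1) * solid_at n (M + q) u) *s cvec u"]
  have r: "sqrt ((real (Suc n) + 1 - 1) * (2 * (real (Suc n) + 1) - 3)) = s1 * s2"
    unfolding s1_def s2_def real_sqrt_mult[symmetric] by (simp add: algebra_simps)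
  have "vec_Y n (Suc n) (M + q) u = (1 / of_real (s1 * s2)) *s vsh_V n (sph_harm n (M + q)) u"
    unfolding vec_Y_def Let_def r by simp
  then show ?thesis unfolding E[symmetric] vsh_sph_harm[OF u] by simp
qed

section \<open>Recoupling of a scalar harmonic with a constant vector\<close>

lemma solid_grad_Suc:
  "solid_grad (Suc k) m x = sph_vec (solid_at k (m - 1) x / of_real (sqrt 2)) (solid_at k m x)
     (solid_at k (m + 1) x / of_real (sqrt 2))"
  by (simp add: solid_grad_def)

text \<open>Orthogonality of the Clebsch--Gordan coefficients in \<open>j\<close>, combined with the expansion of \<open>vec_Y\<close> in the
  spherical basis. All three \<open>vec_Y j k\<close> are combinations of harmonics of the same degree \<open>k\<close>, so the identity can be
  checked component by component as an identity between rational functions of \<open>k\<close> and \<open>M\<close>. For \<open>k = 0\<close> the only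
  possible \<open>j\<close> is \<open>1\<close>.\<close>

theorem vec_Y_recoupling:
  assumes u: "norm u = 1" and M: "\<bar>M\<bar> \<le> int k" and q: "\<bar>q\<bar> \<le> 1"
  shows "(\<Sum>j\<in>{nat \<bar>int k - 1\<bar>..Suc k}. of_real (clebsch_gordan k M 1 q j (M + q)) *s vec_Y j k (M + q) u)
    = sph_harm k M u *s sph_unit q"
proof (cases k)
  case 0
  then have [simp]: "M = 0" using M by simp
  define w where "w = complex_of_real (sqrt 2)"
  have w: "w * w = 2" "w \<noteq> 0" by (simp_all add: w_def)
  have ww: "w * (w * x) = 2 * x" for x using w by (metis mult.assoc)
  have q3: "q = 1 \<or> q = 0 \<or> q = -1" using q by linarith
  have "(\<Sum>j\<in>{nat \<bar>int k - 1\<bar>..Suc k}. of_real (clebsch_gordan k M 1 q j (M + q)) *s vec_Y j k (M + q) u)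
     = of_real (clebsch_gordan k M 1 q (Suc k) (M + q)) *s vec_Y (Suc k) k (M + q) u"
    using 0 by simp
  also have "\<dots> = sph_harm k M u *s sph_unit q"
    unfolding recouple_upper[OF u M q] sph_harm_unit_const[OF u] sph_unit_def solid_grad_Suc sph_vec_scale
    by (rule arg_cong3[of _ _ _ _ _ _ sph_vec])
       (use q3 0 in \<open>auto simp: w_def[symmetric] field_simps w ww\<close>)
  finally show ?thesis .
next
  case (Suc n)
  define w where "w = complex_of_real (sqrt 2)"
  have w: "w * w = 2" "w \<noteq> 0" by (simp_all add: w_def)
  have ww: "w * (w * x) = 2 * x" for x using w by (metis mult.assoc)
  have q3: "q = 1 \<or> q = 0 \<or> q = -1" using q by linarith
  define K m C where "K = complex_of_nat k" and "m = complex_of_int M" and "C = complex_of_real (sph_const k M)"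
  \<comment> \<open>a common denominator of the three rational coefficients\<close>
  define D where "D = 2 * K * (K + 1) * (2 * K + 1)"
  have K: "K \<noteq> 0" "K + 1 \<noteq> 0" "2 * K + 1 \<noteq> 0"
  proof -
    have e: "K + 1 = of_nat (k + 1)" "2 * K + 1 = of_nat (2 * k + 1)" by (simp_all add: K_def)
    have "k \<noteq> 0" using Suc by simp
    then show "K \<noteq> 0" by (simp add: K_def)
    show "K + 1 \<noteq> 0" "2 * K + 1 \<noteq> 0" unfolding e of_nat_eq_0_iff by simp_all
  qed
  then have D: "D \<noteq> 0" by (simp add: D_def)
  have n: "of_nat n = K - 1" "complex_of_real (real n) = K - 1" using Suc by (simp_all add: K_def)
  have k0: "k > 0" using Suc by simp
  have V: "solid_grad n (M + q) u - ((2 * of_nat n + 1) * solid_at n (M + q) u) *s cvec u = sph_vec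
     ((K - of_int (M + q)) * (K - of_int (M + q) + 1) / w * solid_at k (M + q - 1) u)
     (- (K + of_int (M + q)) * (K - of_int (M + q)) * solid_at k (M + q) u)
     ((K + of_int (M + q)) * (K + of_int (M + q) + 1) / w * solid_at k (M + q + 1) u)"
    using solid_grad_irregular[of u n "M + q"] u unfolding n Suc[symmetric] w_def[symmetric]
    by (simp add: algebra_simps)
  define P where "P = (if q = 1 then (K + m + 1) * (K + m + 2) else if q = 0 then (K + 1 + m) * (K + 1 - m)
      else (K - m + 1) * (K - m + 2))"
  define Q where "Q = (if q = 1 then - (K + m + 1) else if q = 0 then 2 * m else K - m + 1)"
  define N where "N = complex_of_real (sqrt_fact_prod 1 q)"
  have N: "N \<noteq> 0" by (simp add: N_def del: One_nat_def)
  have Pr: "of_real (if q = 1 then (real k + of_int M + 1) * (real k + of_int M + 2)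
      else if q = 0 then (real k + 1 + of_int M) * (real k + 1 - of_int M)
      else (real k - of_int M + 1) * (real k - of_int M + 2)) = P"
    and Qr: "of_real (if q = 1 then - (real k + of_int M + 1) else if q = 0 then 2 * of_int M else real k - of_int M + 1) = Q"
    by (simp_all add: P_def Q_def K_def m_def)
  have U: "of_real (sph_const k M / sqrt_fact_prod 1 q / ((real k + 1) * (2 * real k + 1)) *
     (if q = 1 then (real k + of_int M + 1) * (real k + of_int M + 2)
      else if q = 0 then (real k + 1 + of_int M) * (real k + 1 - of_int M)
      else (real k - of_int M + 1) * (real k - of_int M + 2))) = C / N * (2 * K) * P / D"
  proof -
    have "1 / ((K + 1) * (2 * K + 1)) = 2 * K / D" using K by (simp add: D_def)
    then have "C / N * P * (1 / ((K + 1) * (2 * K + 1))) = C / N * (2 * K) * P / D" by simp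
    then show ?thesis unfolding of_real_mult Pr by (simp add: C_def N_def K_def del: One_nat_def)
  qed
  have Mi: "- \<i> * of_real (sph_const k M * sqrt_fact_prod 1 q / (2 * real k * (real k + 1)) *
      (if q = 1 then - (real k + of_int M + 1) else if q = 0 then 2 * of_int M else real k - of_int M + 1))
     = - \<i> * (C * N * (2 * K + 1) * Q) / D"
  proof -
    have "1 / (2 * K * (K + 1)) = (2 * K + 1) / D" using K by (simp add: D_def)
    then have "C * N * Q * (1 / (2 * K * (K + 1))) = C * N * (2 * K + 1) * Q / D" by simp
    then show ?thesis unfolding of_real_mult Qr by (simp add: C_def N_def K_def del: One_nat_def)
  qed
  have L: "of_real (sph_const k M / sqrt_fact_prod 1 q / (real k * (2 * real n + 3)) * (-1) powi (1 + q))
    = C / N * (2 * (K + 1)) * (-1) powi (1 + q) / D"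
  proof -
    have e: "2 * (K - 1) + 3 = 2 * K + 1" by simp
    have "1 / (K * (2 * (K - 1) + 3)) = 2 * (K + 1) / D" unfolding e using K D
      by (subst frac_eq_eq) (simp_all add: D_def)
    then have "C / N * (-1) powi (1 + q) * (1 / (K * (2 * (K - 1) + 3))) = C / N * (2 * (K + 1)) * (-1) powi (1 + q) / D" by simp
    then show ?thesis unfolding n(2)[symmetric] by (simp add: C_def N_def K_def del: One_nat_def)
  qed
  have comb: "a / D * x + b / D * y + c / D * z = t" if "a * x + b * y + c * z = D * t" for a b c x y z t
    using that D by (simp add: field_simps)
  have "{nat \<bar>int k - 1\<bar>..Suc k} = {n, Suc n, Suc (Suc n)}" using Suc by auto
  then have "(\<Sum>j\<in>{nat \<bar>int k - 1\<bar>..Suc k}. of_real (clebsch_gordan k M 1 q j (M + q)) *s vec_Y j k (M + q) u)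
     = of_real (clebsch_gordan k M 1 q n (M + q)) *s vec_Y n k (M + q) u
     + of_real (clebsch_gordan k M 1 q k (M + q)) *s vec_Y k k (M + q) u
     + of_real (clebsch_gordan k M 1 q (Suc k) (M + q)) *s vec_Y (Suc k) k (M + q) u"
    using Suc by (simp add: add_ac)
  also have "\<dots> = sph_harm k M u *s sph_unit q"
    unfolding recouple_upper[OF u M q] recouple_middle[OF u M q k0] recouple_lower[OF u M[unfolded Suc] q, folded Suc]
      sph_harm_unit_const[OF u] sph_unit_def solid_grad_Suc V ccross_cvec_solid_grad U Mi L sph_vec_scale sph_vec_add
      w_def[symmetric] C_def[symmetric] K_def[symmetric]
  proof ((rule arg_cong3[of _ _ _ _ _ _ sph_vec]; rule comb), goal_cases)
    case 1
    show ?case using q3 by (elim disjE; simp add: N_def P_def Q_def w_def[symmetric] m_def[symmetric]; simp add: w(2) field_simps; simp add: w ww D_def algebra_simps)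
  next
    case 2
    show ?case using q3 by (elim disjE; simp add: N_def P_def Q_def w_def[symmetric] m_def[symmetric]; simp add: w(2) field_simps; simp add: w ww D_def algebra_simps)
  next
    case 3
    show ?case using q3 by (elim disjE; simp add: N_def P_def Q_def w_def[symmetric] m_def[symmetric]; simp add: w(2) field_simps; simp add: w ww D_def algebra_simps)
  qed
  finally show ?thesis .
qed

section \<open>Termwise form of the translated gradient\<close>

lemma sums_vecI:
  fixes f :: "nat \<Rightarrow> 'a::real_normed_vector ^ 'n"
  assumes "\<And>i. (\<lambda>n. f n $ i) sums (s $ i)"
  shows "f sums s"
  using assms unfolding sums_def by (intro vec_tendstoI) simp

lemma sums_vec_nth: "f sums s \<Longrightarrow> (\<lambda>n. f n $ i) sums (s $ i)"
  for f :: "nat \<Rightarrow> 'a::real_normed_vector ^ 'n"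
  unfolding sums_def using tendsto_vec_nth[of "\<lambda>n. sum f {..<n}" s sequentially i] by simp

lemma sums_ccross: "f sums s \<Longrightarrow> (\<lambda>n. ccross v (f n)) sums ccross v s"
proof (rule sums_vecI)
  fix i assume "f sums s"
  then have "\<And>i. (\<lambda>n. f n $ i) sums (s $ i)" by (rule sums_vec_nth)
  then have "\<forall>i. (\<lambda>n. ccross v (f n) $ i) sums (ccross v s $ i)"
    unfolding forall_3 ccross_def vector_3 by (intro conjI sums_diff sums_mult)
  then show "(\<lambda>n. ccross v (f n) $ i) sums (ccross v s $ i)" ..
qed

lemma sums_vector_scale: "f sums s \<Longrightarrow> (\<lambda>n. c *s f n) sums (c *s s)"
  for f :: "nat \<Rightarrow> complex ^ 'n"
  by (rule sums_vecI) (use sums_vec_nth[of f s] in \<open>auto intro!: sums_mult\<close>)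

lemma sums_sph_vec:
  "a sums a' \<Longrightarrow> b sums b' \<Longrightarrow> c sums c' \<Longrightarrow> (\<lambda>n. sph_vec (a n) (b n) (c n)) sums sph_vec a' b' c'"
proof (rule sums_vecI)
  fix i assume "a sums a'" "b sums b'" "c sums c'"
  then have "\<forall>i. (\<lambda>n. sph_vec (a n) (b n) (c n) $ i) sums (sph_vec a' b' c' $ i)"
    unfolding forall_3 sph_vec_nth by (intro conjI sums_diff sums_divide sums_add sums_mult)
  then show "(\<lambda>n. sph_vec (a n) (b n) (c n) $ i) sums (sph_vec a' b' c' $ i)" ..
qed

text \<open>The gradient of \<open>irreg l m\<close>, as read off from \<open>irreg_has_derivative\<close>.\<close>

definition irreg_grad :: "nat \<Rightarrow> int \<Rightarrow> real^3 \<Rightarrow> complex^3" where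
  "irreg_grad l m x = sph_vec (irreg (Suc l) (m - 1) x / of_real (sqrt 2)) (- irreg (Suc l) m x) (irreg (Suc l) (m + 1) x / of_real (sqrt 2))"

text \<open>The part of \<open>irreg_grad l m (r + a)\<close> that has degree \<open>n\<close> in \<open>r\<close>, i.e. the gradient in \<open>r\<close> of the part of
  \<open>irreg l m (r + a)\<close> of degree \<open>n + 1\<close>.\<close>

definition grad_term :: "nat \<Rightarrow> int \<Rightarrow> nat \<Rightarrow> real^3 \<Rightarrow> real^3 \<Rightarrow> complex^3" where
  "grad_term l m n r a = (\<Sum>\<mu>\<in>{- int (Suc n)..int (Suc n)}.
     ((-1) powi (int (Suc n) + \<mu>) * irreg (l + Suc n) (m - \<mu>) a) *s solid_grad (Suc n) \<mu> r)"

lemma sph_vec_sum: "(\<Sum>i\<in>I. sph_vec (f i) (g i) (h i)) = sph_vec (sum f I) (sum g I) (sum h I)"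
  by (induction I rule: infinite_finite_induct) (auto simp: sph_vec_zero sph_vec_add)

text \<open>Each component of \<open>solid_grad (Suc n) \<mu> r\<close> is a harmonic of degree \<open>n\<close> and order \<open>\<mu>\<close> or \<open>\<mu> \<plusminus> 1\<close>. Shifting the
  summation index by that difference moves it over to \<open>m\<close>.\<close>

lemma grad_term_eq:
  "grad_term l m n r a = sph_vec (irreg_taylor (Suc l) (m - 1) n r a / of_real (sqrt 2)) (- irreg_taylor (Suc l) m n r a)
     (irreg_taylor (Suc l) (m + 1) n r a / of_real (sqrt 2))"
proof -
  have s: "(-1) powi (1 + int n + \<mu>) = - ((-1) powi (int n + \<mu>) :: complex)"
      "(-1) powi (int n + (\<mu> - 1)) = - ((-1) powi (int n + \<mu>) :: complex)"
      "(-1) powi (int n + (\<mu> + 1)) = - ((-1) powi (int n + \<mu>) :: complex)" for \<mu>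
      by (simp_all add: power_int_add power_int_diff)
  have T: "irreg_taylor (Suc l) k n r a = (\<Sum>\<mu>\<in>{- int (Suc n)..int (Suc n)}.
     (-1) powi (int n + (\<mu> + c)) * solid_at n (\<mu> + c) r * irreg (l + Suc n) (k - (\<mu> + c)) a)" if "\<bar>c\<bar> \<le> 1" for k c
    unfolding irreg_taylor_def
    by (subst sum_symmetric_shift[OF that]) (simp_all add: solid_eq_0)
  show ?thesis
    unfolding grad_term_def solid_grad_Suc sph_vec_scale sph_vec_sum T[of "-1" "m - 1", simplified] T[of 0 m, simplified]
      T[of 1 "m + 1", simplified] sum_divide_distrib sum_negf[symmetric]
    by (intro arg_cong3[of _ _ _ _ _ _ sph_vec] sum.cong refl; simp add: s; simp add: mult_ac)
qed

lemma grad_term_sums: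
  assumes "norm r < norm a" "0 < norm r" "\<bar>m\<bar> \<le> int l"
  shows "(\<lambda>n. grad_term l m n r a) sums irreg_grad l m (r + a)"
  unfolding grad_term_eq irreg_grad_def
  by (intro sums_sph_vec sums_divide sums_minus irreg_addition assms) (use assms(3) in auto)

lemma irreg_grad_eq:
  assumes x: "x \<noteq> 0" and m: "\<bar>m\<bar> \<le> int l"
  shows "irreg_grad l m x = of_real (fact_prod l m / norm x ^ (2 * l + 3)) *s
    (of_real ((norm x)\<^sup>2) *s solid_grad l m x - ((2 * of_nat l + 1) * solid_at l m x) *s cvec x)"
proof -
  have e: "2 * Suc l + 1 = 2 * l + 3" by simp
  show ?thesis
    unfolding solid_grad_irregular sph_vec_scale irreg_grad_def irreg_def fact_prod_Suc[OF m, symmetric] e minus_mult_left[symmetric]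
    by (rule arg_cong3[of _ _ _ _ _ _ sph_vec]) (simp_all del: solid.simps)
qed

text \<open>The gradients of \<open>R\<^sub>l\<^sup>m\<close> and of \<open>R\<^sub>l\<^sup>m / |x|\<^bsup>2l+1\<^esup>\<close> are proportional modulo radial vectors.\<close>

lemma ccross_irreg_grad:
  assumes x: "x \<noteq> 0" and m: "\<bar>m\<bar> \<le> int l"
  shows "ccross (cvec x) (irreg_grad l m x) = of_real (fact_prod l m / norm x ^ (2 * l + 1)) *s ccross (cvec x) (solid_grad l m x)"
  unfolding irreg_grad_eq[OF assms] ccross_linear using x
  by (simp add: power2_eq_square power_add eval_nat_numeral)

text \<open>The components of \<open>x \<times> \<nabla>R\<^sub>l\<^sup>m\<close> are harmonics of degree \<open>l\<close> by \<open>ccross_cvec_solid_grad\<close>.\<close>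

lemma ccross_solid_grad_scale:
  "ccross (cvec (c *\<^sub>R x)) (solid_grad l m (c *\<^sub>R x)) = of_real c ^ l *s ccross (cvec x) (solid_grad l m x)"
  unfolding ccross_cvec_solid_grad solid_at_scaleR by (simp add: vec_eq_iff forall_3 field_simps)

lemma vsh_X_sgn:
  assumes "x \<noteq> 0"
  shows "vsh_X l (sph_harm l m) (sgn x) = of_real (sph_const l m * inverse (norm x) ^ l) *s ccross (cvec x) (solid_grad l m x)"
proof -
  have "norm (sgn x) = 1" using assms by (simp add: norm_sgn)
  then show ?thesis
    unfolding vsh_sph_harm[OF \<open>norm (sgn x) = 1\<close>] unfolding sgn_div_norm ccross_solid_grad_scale by simp
qed

text \<open>The coefficient of \<open>r \<times> \<nabla>R\<^sub>\<lambda>\<^sup>\<mu>(r)\<close> in the first sum and also of \<open>a \<times> \<nabla>R\<^sub>\<lambda>\<^sup>\<mu>(r)\<close> in the second.\<close>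

definition translation_coeff :: "nat \<Rightarrow> nat \<Rightarrow> int \<Rightarrow> int \<Rightarrow> real^3 \<Rightarrow> complex" where
  "translation_coeff l la m \<mu> a = of_real (sqrt ((2 * real l + 1) / (4 * pi)) / sqrt_fact_prod l m)
     * ((-1) powi (int la + \<mu>) * irreg (l + la) (m - \<mu>) a)"

text \<open>The four factorials in the denominators of the two binomial coefficients are those of the orders \<open>\<mu>\<close> and \<open>m\<close>.\<close>

lemma binom_factor_eq:
  assumes "\<bar>m\<bar> \<le> int l" "\<bar>\<mu>\<bar> \<le> int la"
  shows "binom_factor l la m \<mu> = sqrt_fact_prod (l + la) (m - \<mu>) / (sqrt_fact_prod la \<mu> * sqrt_fact_prod l m)"
proof -
  have 1: "real (nat (int l + int la + \<mu> - m) choose nat (int la + \<mu>)) =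
    fact (nat (int (l + la) - (m - \<mu>))) / (fact (nat (int la + \<mu>)) * fact (nat (int l - m)))"
    using assms by (subst binomial_fact) (auto simp: nat_diff_distrib'[symmetric] algebra_simps intro!: arg_cong[of _ _ "\<lambda>x. fact x"])
  have 2: "real (nat (int l + int la + m - \<mu>) choose nat (int la - \<mu>)) =
    fact (nat (int (l + la) + (m - \<mu>))) / (fact (nat (int la - \<mu>)) * fact (nat (int l + m)))"
    using assms by (subst binomial_fact) (auto simp: nat_diff_distrib'[symmetric] algebra_simps intro!: arg_cong[of _ _ "\<lambda>x. fact x"])
  show ?thesis unfolding binom_factor_def 1 2 sqrt_fact_prod_def fact_prod_def
    unfolding real_sqrt_mult[symmetric] real_sqrt_divide[symmetric] by (simp add: mult_ac)
qed

lemma H_coeff_eq: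
  assumes a: "a \<noteq> 0" and "\<bar>m\<bar> \<le> int l" "\<bar>\<mu>\<bar> \<le> int la"
  shows "H_coeff l la m \<mu> a * of_real (sph_const la \<mu>) = translation_coeff l la m \<mu> a"
proof -
  define s where "s = sqrt (2 * real la + 1)"
  have s: "s \<noteq> 0" by (simp add: s_def add_nonneg_eq_0_iff)
  show ?thesis
    unfolding H_coeff_def translation_coeff_def binom_factor_eq[OF assms(2,3)] irreg_eq_irreg_solid[OF a] sph_const_def
      real_sqrt_divide s_def[symmetric] using s by (simp add: field_simps)
qed

lemma first_sum_term:
  assumes "a \<noteq> 0" "r \<noteq> 0" "\<bar>m\<bar> \<le> int l" "\<bar>\<mu>\<bar> \<le> int la"
  shows "(of_real (norm r ^ la) * H_coeff l la m \<mu> a) *s vsh_X la (sph_harm la \<mu>) (sgn r)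
    = translation_coeff l la m \<mu> a *s ccross (cvec r) (solid_grad la \<mu> r)"
  unfolding vsh_X_sgn[OF assms(2)] H_coeff_eq[OF assms(1,3,4), symmetric] using assms(2)
  by (simp add: field_simps)

text \<open>The component along \<open>sph_unit q\<close> of \<open>\<nabla>R\<^sub>\<lambda>\<^sup>\<mu>\<close>, \<open>\<lambda> = k + 1\<close>, in terms of Clebsch--Gordan coefficients: the expansion of
  the harmonic \<open>W\<close> in the spherical basis. For \<open>\<bar>\<mu> - q\<bar> > k\<close> both sides are \<open>0\<close>.\<close>

lemma gradient_clebsch_gordan:
  assumes u: "norm u = 1" and q: "\<bar>q\<bar> \<le> 1" and \<mu>: "\<bar>\<mu>\<bar> \<le> int (Suc k)"
  shows "of_real (sqrt (real (Suc k)) * clebsch_gordan k (\<mu> - q) 1 q (Suc k) \<mu>) * sph_harm k (\<mu> - q) u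
    = of_real (sqrt_fact_prod (Suc k) \<mu> / sqrt (4 * pi) / sqrt_fact_prod 1 q) * solid_at k (\<mu> - q) u"
proof (cases "\<bar>\<mu> - q\<bar> \<le> int k")
  case True
  define s1 s2 where "s1 = sqrt (real k + 1)" and "s2 = sqrt (2 * real k + 1)"
  have s: "s1 \<noteq> 0" "s2 \<noteq> 0" by (simp_all add: s1_def s2_def add_nonneg_eq_0_iff)
  have c: "clebsch_gordan k (\<mu> - q) 1 q (Suc k) \<mu> = sqrt_fact_prod (Suc k) \<mu> / (s1 * s2 * sqrt_fact_prod k (\<mu> - q) * sqrt_fact_prod 1 q)"
    using clebsch_gordan_1_upper[OF True q] by (simp add: s1_def s2_def real_sqrt_mult)
  have s1: "sqrt (real (Suc k)) = s1" by (simp add: s1_def add.commute)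
  show ?thesis
    unfolding c sph_harm_unit_const[OF u] sph_const_def real_sqrt_divide s2_def[symmetric] s1 using s by (simp add: field_simps)
next
  case False
  then show ?thesis by (simp add: clebsch_gordan_def solid_eq_0)
qed

text \<open>Passing to real orders is the same linear operation on every family, so it commutes with sums, limits and
  linear maps.\<close>

lemma real_order_linear:
  obtains \<alpha> \<beta> where "\<And>F. real_order F m = \<alpha> * F m + \<beta> * F (- m)"
proof -
  consider "m > 0" | "m = 0" | "m < 0" by linarith
  then show thesis
  proof cases
    case 1 then show thesis
      by (intro that[of "(-1) powi m / of_real (sqrt 2)" "1 / of_real (sqrt 2)"]) (simp add: real_order_def field_simps)
  next
    case 2 then show thesis by (intro that[of 1 0]) (simp add: real_order_def)
  next
    case 3 then show thesis
      by (intro that[of "\<i> / of_real (sqrt 2)" "- \<i> / of_real (sqrt 2) * (-1) powi m"]) (simp add: real_order_def field_simps)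
  qed
qed

lemma cvec_add: "cvec (x + y) = cvec x + cvec y"
  by (simp add: vec_eq_iff cvec_def)

lemma cvec_sph_comp: "cvec a = sph_vec (- sph_comp_neg a 1) (sph_comp_neg a 0) (- sph_comp_neg a (-1))"
  unfolding cvec_sph_vec by (rule arg_cong3[of _ _ _ _ _ _ sph_vec]) (simp_all add: sph_comp_neg_def Complex_eq field_simps)

text \<open>The multiplication table \<open>e\<^sub>q \<times> e\<^sub>p = \<i> sgn (q - p) e\<^bsub>q+p\<^esub>\<close>, which is where the sign factor of the second sum comes
  from.\<close>

lemma ccross_spherical_sum:
  fixes A B :: "int \<Rightarrow> complex"
  shows "(\<Sum>q\<in>{-1..1}. \<Sum>p\<in>{-1..1}. (A q * B p * (\<i> * of_int (sgn (q - p)))) *s sph_unit (q + p))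
    = ccross (sph_vec (A 1) (A 0) (A (-1))) (sph_vec (B 1) (B 0) (B (-1)))"
proof -
  have s: "{-1..1} = {-1, 0, 1 :: int}" by auto
  show ?thesis unfolding s ccross_sph_vec
    by (simp add: sph_unit_def sph_vec_scale sph_vec_add sph_vec_zero)
       (rule arg_cong3[of _ _ _ _ _ _ sph_vec]; simp add: algebra_simps)
qed

text \<open>The sum over \<open>j\<close> undoes the coupling. If \<open>q = p\<close> the sign factor vanishes; otherwise \<open>\<bar>q + p\<bar> \<le> 1\<close>, and if the order
  \<open>\<mu> - p\<close> exceeds the degree the first Clebsch--Gordan coefficient vanishes; in the remaining cases
  \<open>vec_Y_recoupling\<close> applies.\<close>

lemma inner_j_sum:
  assumes a: "a \<noteq> 0" and r: "r \<noteq> 0" and m: "\<bar>m\<bar> \<le> int l" and \<mu>: "\<bar>\<mu>\<bar> \<le> int (Suc k)"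
    and q: "\<bar>q\<bar> \<le> 1" and p: "\<bar>p\<bar> \<le> 1"
  shows "(\<Sum>j\<in>{nat \<bar>int (Suc k) - 2\<bar>..Suc k}. (of_real (norm r ^ k) * L_coeff l j (Suc k) m \<mu> q p a) *s vec_Y j k (q + \<mu>) (sgn r))
    = (translation_coeff l (Suc k) m \<mu> a * ((-1) powi q * sph_comp_neg a q) * (of_real (1 / sqrt_fact_prod 1 p) * solid_at k (\<mu> - p) r)
        * (\<i> * of_int (sgn (q - p)))) *s sph_unit (q + p)"
proof -
  have u: "norm (sgn r) = 1" using r by (simp add: norm_sgn)
  define C where "C = of_real (norm r ^ k) * (\<i> * (-1) powi (int (Suc k) + \<mu> + q) * of_int (sgn (q - p)) * sph_comp_neg a q
     * of_real (sqrt (real (Suc k) * (2 * real l + 1)))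
     * irreg_solid (l + Suc k) (m - \<mu>) a * of_real (binom_factor l (Suc k) m \<mu>)
     * of_real (clebsch_gordan k (\<mu> - p) 1 p (Suc k) \<mu>))"
  have set: "{nat \<bar>int (Suc k) - 2\<bar>..Suc k} = {nat \<bar>int k - 1\<bar>..Suc k}" by (rule arg_cong2[of _ _ _ _ atLeastAtMost]) auto
  have "(\<Sum>j\<in>{nat \<bar>int (Suc k) - 2\<bar>..Suc k}. (of_real (norm r ^ k) * L_coeff l j (Suc k) m \<mu> q p a) *s vec_Y j k (q + \<mu>) (sgn r))
    = C *s (\<Sum>j\<in>{nat \<bar>int k - 1\<bar>..Suc k}. of_real (clebsch_gordan k (\<mu> - p) 1 (q + p) j (\<mu> + q)) *s vec_Y j k (\<mu> + q) (sgn r))"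
    unfolding set vec.scale_sum_right
    by (intro sum.cong refl) (simp add: L_coeff_def C_def add.commute)
  also have "\<dots> = (C * sph_harm k (\<mu> - p) (sgn r)) *s sph_unit (q + p)"
  proof (cases "q = p \<or> \<bar>\<mu> - p\<bar> > int k")
    case True
    then have "C = 0" by (auto simp: C_def clebsch_gordan_def)
    then show ?thesis by simp
  next
    case False
    then have "\<bar>q + p\<bar> \<le> 1" "\<bar>\<mu> - p\<bar> \<le> int k" using q p by auto
    from vec_Y_recoupling[OF u this(2,1)] show ?thesis by (simp add: add.commute)
  qed
  also have "C * sph_harm k (\<mu> - p) (sgn r) = translation_coeff l (Suc k) m \<mu> a * ((-1) powi q * sph_comp_neg a q)
      * (of_real (1 / sqrt_fact_prod 1 p) * solid_at k (\<mu> - p) r) * (\<i> * of_int (sgn (q - p)))"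
  proof -
    have g: "of_real (sqrt (real (Suc k))) * of_real (clebsch_gordan k (\<mu> - p) 1 p (Suc k) \<mu>) * sph_harm k (\<mu> - p) (sgn r)
        = of_real (sqrt_fact_prod (Suc k) \<mu> / sqrt (4 * pi) / sqrt_fact_prod 1 p) * (solid_at k (\<mu> - p) r / of_real (norm r ^ k))"
    proof -
      have "solid_at k (\<mu> - p) (sgn r) = solid_at k (\<mu> - p) r / of_real (norm r ^ k)"
        unfolding sgn_div_norm solid_at_scaleR by (simp add: field_simps)
      then show ?thesis using gradient_clebsch_gordan[OF u p \<mu>] by (simp only: of_real_mult)
    qed
    have "C * sph_harm k (\<mu> - p) (sgn r) = of_real (norm r ^ k) * (\<i> * (-1) powi (int (Suc k) + \<mu> + q) * of_int (sgn (q - p)) * sph_comp_neg a q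
     * of_real (sqrt (2 * real l + 1)) * irreg_solid (l + Suc k) (m - \<mu>) a * of_real (binom_factor l (Suc k) m \<mu>))
     * (of_real (sqrt (real (Suc k))) * of_real (clebsch_gordan k (\<mu> - p) 1 p (Suc k) \<mu>) * sph_harm k (\<mu> - p) (sgn r))"
      unfolding C_def real_sqrt_mult of_real_mult by (simp only: mult_ac)
    also have "\<dots> = translation_coeff l (Suc k) m \<mu> a * ((-1) powi q * sph_comp_neg a q)
      * (of_real (1 / sqrt_fact_prod 1 p) * solid_at k (\<mu> - p) r) * (\<i> * of_int (sgn (q - p)))"
      unfolding g translation_coeff_def binom_factor_eq[OF m \<mu>] irreg_eq_irreg_solid[OF a] real_sqrt_divide
      using r by (simp add: field_simps power_int_add)
    finally show ?thesis .
  qed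
  finally show ?thesis by (simp only: mult.assoc)
qed

lemma second_sum_term:
  assumes a: "a \<noteq> 0" and r: "r \<noteq> 0" and m: "\<bar>m\<bar> \<le> int l" and \<mu>: "\<bar>\<mu>\<bar> \<le> int (Suc k)"
  shows "(\<Sum>q\<in>{-1..1}. \<Sum>p\<in>{-1..1}. \<Sum>j\<in>{nat \<bar>int (Suc k) - 2\<bar>..Suc k}.
      (of_real (norm r ^ k) * L_coeff l j (Suc k) m \<mu> q p a) *s vec_Y j k (q + \<mu>) (sgn r))
    = translation_coeff l (Suc k) m \<mu> a *s ccross (cvec a) (solid_grad (Suc k) \<mu> r)"
proof -
  define A where "A q = (-1) powi q * sph_comp_neg a q" for q
  define B where "B p = of_real (1 / sqrt_fact_prod 1 p) * solid_at k (\<mu> - p) r" for p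
  have "(\<Sum>q\<in>{-1..1}. \<Sum>p\<in>{-1..1}. \<Sum>j\<in>{nat \<bar>int (Suc k) - 2\<bar>..Suc k}.
      (of_real (norm r ^ k) * L_coeff l j (Suc k) m \<mu> q p a) *s vec_Y j k (q + \<mu>) (sgn r))
    = (\<Sum>q\<in>{-1..1}. \<Sum>p\<in>{-1..1}. translation_coeff l (Suc k) m \<mu> a *s ((A q * B p * (\<i> * of_int (sgn (q - p)))) *s sph_unit (q + p)))"
    by (intro sum.cong refl, subst inner_j_sum[OF a r m \<mu>]) (auto simp: A_def B_def mult.assoc)
  also have "\<dots> = translation_coeff l (Suc k) m \<mu> a *s ccross (sph_vec (A 1) (A 0) (A (-1))) (sph_vec (B 1) (B 0) (B (-1)))"
    unfolding ccross_spherical_sum[symmetric] vec.scale_sum_right ..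
  also have "sph_vec (A 1) (A 0) (A (-1)) = cvec a" unfolding cvec_sph_comp by (simp add: A_def)
  also have "sph_vec (B 1) (B 0) (B (-1)) = solid_grad (Suc k) \<mu> r" unfolding solid_grad_Suc by (simp add: B_def)
  finally show ?thesis .
qed

section \<open>The translation theorem\<close>

lemma ccross_sum: "ccross v (sum f I) = (\<Sum>i\<in>I. ccross v (f i))"
proof -
  have "ccross v 0 = 0" by (simp add: vec_eq_iff forall_3 ccross_def vector_3)
  then show ?thesis by (induction I rule: infinite_finite_induct) (auto simp: ccross_linear)
qed

lemma translation_coeff_sum:
  "(\<Sum>\<mu>\<in>{- int (Suc n)..int (Suc n)}. translation_coeff l (Suc n) m \<mu> a *s ccross v (solid_grad (Suc n) \<mu> r))
    = of_real (sqrt ((2 * real l + 1) / (4 * pi)) / sqrt_fact_prod l m) *s ccross v (grad_term l m n r a)"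
  unfolding grad_term_def ccross_sum ccross_linear vec.scale_sum_right translation_coeff_def
  by (intro sum.cong refl) simp

text \<open>Both sums have the same coefficients against \<open>r \<times> \<nabla>R\<^sub>\<lambda>\<^sup>\<mu>\<close> and \<open>a \<times> \<nabla>R\<^sub>\<lambda>\<^sup>\<mu>\<close>, so they converge to
  \<open>r \<times> \<nabla>J\<close> and \<open>a \<times> \<nabla>J\<close> at \<open>r + a\<close>, times one constant, and these add up to \<open>(r + a) \<times> \<nabla>J\<close>.\<close>

lemma translation_complex_order:
  fixes r a :: "real^3"
  assumes ar: "norm a > norm r" and r: "norm r > 0" and m: "\<bar>m\<bar> \<le> int l"
  obtains S T where
    "(\<lambda>n. \<Sum>\<mu>\<in>{- int (Suc n)..int (Suc n)}. (of_real (norm r ^ Suc n) * H_coeff l (Suc n) m \<mu> a)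
        *s vsh_X (Suc n) (sph_harm (Suc n) \<mu>) (sgn r)) sums S"
    "(\<lambda>n. \<Sum>\<mu>\<in>{- int (Suc n)..int (Suc n)}. \<Sum>q\<in>{-1..1}. \<Sum>p\<in>{-1..1}. \<Sum>j\<in>{nat \<bar>int (Suc n) - 2\<bar>..Suc n}.
        (of_real (norm r ^ n) * L_coeff l j (Suc n) m \<mu> q p a) *s vec_Y j n (q + \<mu>) (sgn r)) sums T"
    "of_real (norm (r + a) powi (- int l - 1)) *s vsh_X l (sph_harm l m) (sgn (r + a)) = S + T"
proof
  let ?D = "complex_of_real (sqrt ((2 * real l + 1) / (4 * pi)) / sqrt_fact_prod l m)"
  have a0: "a \<noteq> 0" and r0: "r \<noteq> 0" using ar r by auto
  have x0: "r + a \<noteq> 0" using ar by (metis add_eq_0_iff norm_minus_cancel less_irrefl)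
  have c: "(\<lambda>n. ?D *s ccross v (grad_term l m n r a)) sums (?D *s ccross v (irreg_grad l m (r + a)))" for v
    by (intro sums_vector_scale sums_ccross grad_term_sums ar r m)
  have "(\<Sum>\<mu>\<in>{- int (Suc n)..int (Suc n)}. (of_real (norm r ^ Suc n) * H_coeff l (Suc n) m \<mu> a)
        *s vsh_X (Suc n) (sph_harm (Suc n) \<mu>) (sgn r)) = ?D *s ccross (cvec r) (grad_term l m n r a)" for n
    unfolding translation_coeff_sum[symmetric]
    by (intro sum.cong refl first_sum_term a0 r0 m) auto
  then show "(\<lambda>n. \<Sum>\<mu>\<in>{- int (Suc n)..int (Suc n)}. (of_real (norm r ^ Suc n) * H_coeff l (Suc n) m \<mu> a)
        *s vsh_X (Suc n) (sph_harm (Suc n) \<mu>) (sgn r)) sums (?D *s ccross (cvec r) (irreg_grad l m (r + a)))"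
    using c by simp
  have "(\<Sum>\<mu>\<in>{- int (Suc n)..int (Suc n)}. \<Sum>q\<in>{-1..1}. \<Sum>p\<in>{-1..1}. \<Sum>j\<in>{nat \<bar>int (Suc n) - 2\<bar>..Suc n}.
        (of_real (norm r ^ n) * L_coeff l j (Suc n) m \<mu> q p a) *s vec_Y j n (q + \<mu>) (sgn r))
      = ?D *s ccross (cvec a) (grad_term l m n r a)" for n
    unfolding translation_coeff_sum[symmetric]
    by (intro sum.cong refl second_sum_term a0 r0 m) auto
  then show "(\<lambda>n. \<Sum>\<mu>\<in>{- int (Suc n)..int (Suc n)}. \<Sum>q\<in>{-1..1}. \<Sum>p\<in>{-1..1}. \<Sum>j\<in>{nat \<bar>int (Suc n) - 2\<bar>..Suc n}.
        (of_real (norm r ^ n) * L_coeff l j (Suc n) m \<mu> q p a) *s vec_Y j n (q + \<mu>) (sgn r))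
      sums (?D *s ccross (cvec a) (irreg_grad l m (r + a)))"
    using c by (simp only:)
  have "?D *s ccross (cvec r) (irreg_grad l m (r + a)) + ?D *s ccross (cvec a) (irreg_grad l m (r + a))
    = ?D *s ccross (cvec (r + a)) (irreg_grad l m (r + a))"
    unfolding cvec_add ccross_linear by (simp add: vec.scale_right_distrib)
  also have "\<dots> = of_real (norm (r + a) powi (- int l - 1)) *s vsh_X l (sph_harm l m) (sgn (r + a))"
  proof -
    have e1: "sqrt ((2 * real l + 1) / (4 * pi)) / sqrt_fact_prod l m * fact_prod l m = sph_const l m"
      unfolding sqrt_fact_prod_square[symmetric] by (simp add: sph_const_def)
    have e2: "1 / norm (r + a) ^ (2 * l + 1) = norm (r + a) powi (- int l - 1) * inverse (norm (r + a)) ^ l"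
      unfolding powi_minus_Suc by (simp add: field_simps mult_2_right power_add)
    have "sqrt ((2 * real l + 1) / (4 * pi)) / sqrt_fact_prod l m * (fact_prod l m / norm (r + a) ^ (2 * l + 1))
       = sqrt ((2 * real l + 1) / (4 * pi)) / sqrt_fact_prod l m * fact_prod l m * (1 / norm (r + a) ^ (2 * l + 1))"
      by simp
    also have "\<dots> = norm (r + a) powi (- int l - 1) * (sph_const l m * inverse (norm (r + a)) ^ l)"
      unfolding e1 e2 by (simp only: mult_ac)
    finally have "sqrt ((2 * real l + 1) / (4 * pi)) / sqrt_fact_prod l m * (fact_prod l m / norm (r + a) ^ (2 * l + 1))
       = norm (r + a) powi (- int l - 1) * (sph_const l m * inverse (norm (r + a)) ^ l)" .
    then show ?thesis unfolding ccross_irreg_grad[OF x0 m] vsh_X_sgn[OF x0] vec.scale_scale of_real_mult[symmetric]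
      by (simp only:)
  qed
  finally show "of_real (norm (r + a) powi (- int l - 1)) *s vsh_X l (sph_harm l m) (sgn (r + a)) =
    ?D *s ccross (cvec r) (irreg_grad l m (r + a)) + ?D *s ccross (cvec a) (irreg_grad l m (r + a))" ..
qed

lemma surf_grad_sph_harm_combination:
  assumes u: "norm u = 1"
  shows "surf_grad (\<lambda>x. \<alpha> * sph_harm l m x + \<beta> * sph_harm l k x) u =
    \<alpha> *s surf_grad (sph_harm l m) u + \<beta> *s surf_grad (sph_harm l k) u"
proof -
  note d = sph_harm_has_derivative[OF u]
  show ?thesis
    unfolding surf_grad_def
      frechet_derivative_at[OF has_derivative_add[OF has_derivative_mult_right[OF d] has_derivative_mult_right[OF d]], symmetric]
      frechet_derivative_at[OF d, symmetric]
    by (simp add: vec_eq_iff)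
qed

lemma vsh_real_sph_harm:
  fixes Z :: "nat \<Rightarrow> (real^3 \<Rightarrow> complex) \<Rightarrow> real^3 \<Rightarrow> complex^3"
  assumes u: "norm u = 1" and Z: "Z \<in> {vsh_V, vsh_W, vsh_X}"
  shows "Z l (real_sph_harm l m) u $ i = real_order (\<lambda>k. Z l (sph_harm l k) u $ i) m"
proof -
  obtain \<alpha> \<beta> where ab: "\<And>F. real_order F m = \<alpha> * F m + \<beta> * F (- m)"
    using real_order_linear[of m] by blast
  have "real_sph_harm l m = (\<lambda>x. \<alpha> * sph_harm l m x + \<beta> * sph_harm l (- m) x)"
    by (simp add: fun_eq_iff real_sph_harm_def ab)
  then have "Z l (real_sph_harm l m) u = \<alpha> *s Z l (sph_harm l m) u + \<beta> *s Z l (sph_harm l (- m)) u"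
    using Z by (auto simp: vsh_V_def vsh_W_def vsh_X_def surf_grad_sph_harm_combination[OF u] ccross_linear)
       (simp_all add: vec_eq_iff algebra_simps)
  then show ?thesis by (simp add: ab)
qed

lemma real_order_inverse:
  "F \<mu> = (if \<mu> > 0 then (-1) powi \<mu> / of_real (sqrt 2) * (real_order F \<mu> + \<i> * real_order F (- \<mu>))
     else if \<mu> = 0 then real_order F 0
     else 1 / of_real (sqrt 2) * (real_order F (- \<mu>) - \<i> * real_order F \<mu>))"
proof -
  define w where "w = complex_of_real (sqrt 2)"
  have w: "w * w = 2" "w \<noteq> 0" by (simp_all add: w_def)
  have ww: "w * (w * x) = 2 * x" for x using w by (metis mult.assoc)
  have s: "(-1) powi \<mu> * ((-1) powi \<mu> * x) = x" for x :: complex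
    by (simp flip: mult.assoc power_mult_distrib power_int_mult_distrib)
  show ?thesis
    unfolding real_order_def w_def[symmetric] using w(2)
    by (auto simp: power_int_minus_one_minus field_simps ww s w)
qed

theorem theorem3p9:
  fixes r a :: "real^3" and l :: nat and m :: int
  assumes "norm a > norm r" and "norm r > 0" and "\<bar>m\<bar> \<le> int l"
  shows "(\<exists>S T.
      (\<lambda>n. let la = Suc n in
         \<Sum>\<mu>\<in>{- int la..int la}.
           (of_real (norm r ^ la) * real_order (\<lambda>k. H_coeff l la k \<mu> a) m)
             *s vsh_X la (sph_harm la \<mu>) (sgn r)) sums S
    \<and> (\<lambda>n. let la = Suc n in
         \<Sum>\<mu>\<in>{- int la..int la}. \<Sum>q\<in>{-1..1}. \<Sum>m1\<in>{-1..1}. \<Sum>j\<in>{nat \<bar>int la - 2\<bar>..la}.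
           (of_real (norm r ^ (la - 1)) * real_order (\<lambda>k. L_coeff l j la k \<mu> q m1 a) m)
             *s vec_Y j (la - 1) (q + \<mu>) (sgn r)) sums T
    \<and> of_real (norm (r + a) powi (- int l - 1)) *s vsh_X l (real_sph_harm l m) (sgn (r + a))
        = S + T)
  \<and> (\<forall>Z\<in>{vsh_V, vsh_W, vsh_X}. \<forall>la. \<forall>\<mu>. \<bar>\<mu>\<bar> \<le> int la \<longrightarrow>
       Z la (sph_harm la \<mu>) (sgn r) =
         (if \<mu> > 0 then
            ((-1) powi \<mu> / of_real (sqrt 2)) *s
              (Z la (real_sph_harm la \<mu>) (sgn r) + \<i> *s Z la (real_sph_harm la (- \<mu>)) (sgn r))
          else if \<mu> = 0 then Z la (real_sph_harm la 0) (sgn r)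
          else
            (1 / of_real (sqrt 2)) *s
              (Z la (real_sph_harm la (- \<mu>)) (sgn r) - \<i> *s Z la (real_sph_harm la \<mu>) (sgn r))))"
proof (intro conjI ballI allI impI)
  obtain \<alpha> \<beta> where ab: "\<And>F. real_order F m = \<alpha> * F m + \<beta> * F (- m)"
    using real_order_linear[of m] by blast
  obtain S T where ST:
    "(\<lambda>n. \<Sum>\<mu>\<in>{- int (Suc n)..int (Suc n)}. (of_real (norm r ^ Suc n) * H_coeff l (Suc n) m \<mu> a)
        *s vsh_X (Suc n) (sph_harm (Suc n) \<mu>) (sgn r)) sums S"
    "(\<lambda>n. \<Sum>\<mu>\<in>{- int (Suc n)..int (Suc n)}. \<Sum>q\<in>{-1..1}. \<Sum>p\<in>{-1..1}. \<Sum>j\<in>{nat \<bar>int (Suc n) - 2\<bar>..Suc n}.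
        (of_real (norm r ^ n) * L_coeff l j (Suc n) m \<mu> q p a) *s vec_Y j n (q + \<mu>) (sgn r)) sums T"
    "of_real (norm (r + a) powi (- int l - 1)) *s vsh_X l (sph_harm l m) (sgn (r + a)) = S + T"
    using translation_complex_order[OF assms] by blast
  have m': "\<bar>- m\<bar> \<le> int l" using assms(3) by simp
  obtain S' T' where ST':
    "(\<lambda>n. \<Sum>\<mu>\<in>{- int (Suc n)..int (Suc n)}. (of_real (norm r ^ Suc n) * H_coeff l (Suc n) (- m) \<mu> a)
        *s vsh_X (Suc n) (sph_harm (Suc n) \<mu>) (sgn r)) sums S'"
    "(\<lambda>n. \<Sum>\<mu>\<in>{- int (Suc n)..int (Suc n)}. \<Sum>q\<in>{-1..1}. \<Sum>p\<in>{-1..1}. \<Sum>j\<in>{nat \<bar>int (Suc n) - 2\<bar>..Suc n}.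
        (of_real (norm r ^ n) * L_coeff l j (Suc n) (- m) \<mu> q p a) *s vec_Y j n (q + \<mu>) (sgn r)) sums T'"
    "of_real (norm (r + a) powi (- int l - 1)) *s vsh_X l (sph_harm l (- m)) (sgn (r + a)) = S' + T'"
    using translation_complex_order[OF assms(1,2) m'] by blast
  have lin: "(x * (\<alpha> * y + \<beta> * z)) *s v = \<alpha> *s ((x * y) *s v) + \<beta> *s ((x * z) *s v)" for x y z and v :: "complex^3"
    by (simp add: vec_eq_iff algebra_simps)
  have 1: "(\<lambda>n. let la = Suc n in
         \<Sum>\<mu>\<in>{- int la..int la}.
           (of_real (norm r ^ la) * real_order (\<lambda>k. H_coeff l la k \<mu> a) m)
             *s vsh_X la (sph_harm la \<mu>) (sgn r)) sums (\<alpha> *s S + \<beta> *s S')"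
    unfolding Let_def ab lin sum.distrib vec.scale_sum_right[symmetric]
    by (intro sums_add sums_vector_scale ST(1) ST'(1))
  have 2: "(\<lambda>n. let la = Suc n in
         \<Sum>\<mu>\<in>{- int la..int la}. \<Sum>q\<in>{-1..1}. \<Sum>m1\<in>{-1..1}. \<Sum>j\<in>{nat \<bar>int la - 2\<bar>..la}.
           (of_real (norm r ^ (la - 1)) * real_order (\<lambda>k. L_coeff l j la k \<mu> q m1 a) m)
             *s vec_Y j (la - 1) (q + \<mu>) (sgn r)) sums (\<alpha> *s T + \<beta> *s T')"
    unfolding Let_def ab lin sum.distrib vec.scale_sum_right[symmetric] diff_Suc_1
    by (intro sums_add sums_vector_scale ST(2) ST'(2))
  have x0: "r + a \<noteq> 0" using assms(1) by (metis add_eq_0_iff norm_minus_cancel less_irrefl)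
  have "vsh_X l (real_sph_harm l m) (sgn (r + a)) =
     \<alpha> *s vsh_X l (sph_harm l m) (sgn (r + a)) + \<beta> *s vsh_X l (sph_harm l (- m)) (sgn (r + a))"
    using vsh_real_sph_harm[of "sgn (r + a)" vsh_X l m] x0 by (simp add: vec_eq_iff ab norm_sgn)
  then have "of_real (norm (r + a) powi (- int l - 1)) *s vsh_X l (real_sph_harm l m) (sgn (r + a))
     = \<alpha> *s (S + T) + \<beta> *s (S' + T')"
    unfolding ST(3)[symmetric] ST'(3)[symmetric] by (simp add: vec_eq_iff algebra_simps)
  also have "\<dots> = (\<alpha> *s S + \<beta> *s S') + (\<alpha> *s T + \<beta> *s T')"
    by (simp add: vec_eq_iff algebra_simps)
  finally show "\<exists>S T.
      (\<lambda>n. let la = Suc n in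
         \<Sum>\<mu>\<in>{- int la..int la}.
           (of_real (norm r ^ la) * real_order (\<lambda>k. H_coeff l la k \<mu> a) m)
             *s vsh_X la (sph_harm la \<mu>) (sgn r)) sums S
    \<and> (\<lambda>n. let la = Suc n in
         \<Sum>\<mu>\<in>{- int la..int la}. \<Sum>q\<in>{-1..1}. \<Sum>m1\<in>{-1..1}. \<Sum>j\<in>{nat \<bar>int la - 2\<bar>..la}.
           (of_real (norm r ^ (la - 1)) * real_order (\<lambda>k. L_coeff l j la k \<mu> q m1 a) m)
             *s vec_Y j (la - 1) (q + \<mu>) (sgn r)) sums T
    \<and> of_real (norm (r + a) powi (- int l - 1)) *s vsh_X l (real_sph_harm l m) (sgn (r + a))
        = S + T"
    using 1 2 by blast
next
  fix Z la \<mu>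
  assume Z: "Z \<in> {vsh_V, vsh_W, vsh_X}"
  have u: "norm (sgn r) = 1" using assms(2) by (simp add: norm_sgn)
  show "Z la (sph_harm la \<mu>) (sgn r) =
         (if \<mu> > 0 then
            ((-1) powi \<mu> / of_real (sqrt 2)) *s
              (Z la (real_sph_harm la \<mu>) (sgn r) + \<i> *s Z la (real_sph_harm la (- \<mu>)) (sgn r))
          else if \<mu> = 0 then Z la (real_sph_harm la 0) (sgn r)
          else
            (1 / of_real (sqrt 2)) *s
              (Z la (real_sph_harm la (- \<mu>)) (sgn r) - \<i> *s Z la (real_sph_harm la \<mu>) (sgn r)))"
    unfolding vec_eq_iff
  proof
    fix i
    show "Z la (sph_harm la \<mu>) (sgn r) $ i = (if \<mu> > 0 then
            ((-1) powi \<mu> / of_real (sqrt 2)) *s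
              (Z la (real_sph_harm la \<mu>) (sgn r) + \<i> *s Z la (real_sph_harm la (- \<mu>)) (sgn r))
          else if \<mu> = 0 then Z la (real_sph_harm la 0) (sgn r)
          else
            (1 / of_real (sqrt 2)) *s
              (Z la (real_sph_harm la (- \<mu>)) (sgn r) - \<i> *s Z la (real_sph_harm la \<mu>) (sgn r))) $ i"
      by (subst real_order_inverse[of "\<lambda>k. Z la (sph_harm la k) (sgn r) $ i" \<mu>])
         (simp add: vsh_real_sph_harm[OF u Z] ring_distribs add_divide_distrib diff_divide_distrib)
  qed
qed

end
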